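(* The local grounded Martin's Axiom implies that the cardinals on the right side of Cichoń's diagram equal the continuum, i.e. that $\mathbf{cov}(\mathcal{B})=\mathfrak{d}=\mathbf{cof}(\mathcal{B})=\mathbf{non}(\mathcal{L})=\mathbf{cof}(\mathcal{L})=\mathfrak{c}$. In particular, it implies that both the covering number for category $\mathbf{cov}(\mathcal{B})$ and the reaping number $\mathfrak{r}$ equal $\mathfrak{c}$.
   Context: $\mathfrak{c}$ is the cardinality of the continuum. For a cardinal $\kappa$, $H_{\kappa^+}$ is the set of all sets whose transitive closure has cardinality at most $\kappa$. $\mathrm{ZFC}^-$ is ZFC without the power set axiom (with collection). A ccc forcing extension of $M$ is a model of the form $M[G]$ where $\mathbb{P}\in M$ is a poset ccc in $M$ and $G\subseteq\mathbb{P}$ is $M$-generic. The local grounded Martin's Axiom asserts (of the universe $V$) that there are a cardinal $\kappa\geq\mathfrak{c}$ and a transitive $\mathrm{ZFC}^-$ model $M\subseteq H_{\kappa^+}$ such that $H_{\kappa^+}$ is a ccc forcing extension of $M$ and, for every poset $\mathbb{Q}\in M$ which is ccc in $V$ and every family $\mathcal{D}\in V$ of fewer than $\mathfrak{c}$ many dense subsets of $\mathbb{Q}$, there is in $V$ a filter on $\mathbb{Q}$ meeting every element of $\mathcal{D}$. $\mathcal{B}$ is the ideal of meagre sets of reals and $\mathcal{L}$ is the ideal of Lebesgue null sets. For an ideal $\mathcal{I}$ on $\mathbb{R}$: $\mathbf{cov}(\mathcal{I})$ is the least size of a subfamily of $\mathcal{I}$ covering $\mathbb{R}$; $\mathbf{non}(\mathcal{I})$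 is the least size of a set of reals not in $\mathcal{I}$; $\mathbf{cof}(\mathcal{I})$ is the least size of a subfamily of $\mathcal{I}$ cofinal in $(\mathcal{I},\subseteq)$. $\mathfrak{d}$ is the dominating number (least size of a family in ${}^{\omega}\omega$ cofinal under eventual domination). The reaping number $\mathfrak{r}$ is the least size of a family $\mathcal{R}$ of infinite subsets of $\omega$ such that no single set $y\subseteq\omega$ splits all members of $\mathcal{R}$, where $y$ splits $x$ if $x\cap y$ and $x\setminus y$ are both infinite. *)

theory Defs
  imports "HOL-Analysis.Analysis"
begin

unbundle cardinal_syntax

section \<open>Sets of hereditarily bounded size\<close>

text \<open>
  The ambient universe $V$ is that of HOL itself. What is needed of it as a universe of pure sets
  is only $H_{\kappa^+}$ for cardinals $\kappa$. The type \<open>'k hset\<close> built here is the type of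
  all pure well-founded sets that hereditarily have at most \<open>max |'k| \<aleph>\<^sub>0\<close> elements: trees of that
  branching, modulo extensional equality (bisimilarity). The option type lets a node have fewer
  children, in particular none.
\<close>

datatype 'k tree = Node "'k + nat \<Rightarrow> 'k tree option"

primrec children :: "'k tree \<Rightarrow> 'k tree set" where
  "children (Node f) = {t. Some t \<in> range f}"

inductive teq :: "'k tree \<Rightarrow> 'k tree \<Rightarrow> bool" where
  teqI: "rel_set teq (children t) (children u) \<Longrightarrow> teq t u"
monos rel_set_mono

lemma tree_children_induct:
  assumes "\<And>t. (\<And>s. s \<in> children t \<Longrightarrow> P s) \<Longrightarrow> P t"
  shows "P t"
proof (induction t)
  case (Node f)
  show ?case
  proof (rule assms)
    fix s assume "s \<in> children (Node f)"
    then obtain i where "Some s = f i" by auto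
    then show "P s" by (intro Node[OF rangeI[of f i]]) simp
  qed
qed

lemma teq_iff: "teq t u \<longleftrightarrow> rel_set teq (children t) (children u)"
  by (subst teq.simps) auto

lemma teq_refl: "teq t t"
proof (induction t rule: tree_children_induct)
  case (1 t)
  then show ?case by (intro teqI rel_setI) blast+
qed

lemma teq_sym: "teq t u \<Longrightarrow> teq u t"
proof (induction t arbitrary: u rule: tree_children_induct)
  case (1 t)
  have r: "rel_set teq (children t) (children u)" using 1(2) by (simp only: teq_iff[symmetric])
  show ?case
    by (intro teqI rel_setI) (use 1(1) rel_setD1[OF r] rel_setD2[OF r] in blast)+
qed

lemma teq_trans: "teq t u \<Longrightarrow> teq u v \<Longrightarrow> teq t v"
proof (induction t arbitrary: u v rule: tree_children_induct)
  case (1 t)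
  have a: "rel_set teq (children t) (children u)" and b: "rel_set teq (children u) (children v)"
    using 1(2,3) by (simp_all only: teq_iff[symmetric])
  show ?case
  proof (rule teqI, rule rel_setI)
    fix s assume s: "s \<in> children t"
    then obtain s' where s': "s' \<in> children u" "teq s s'" using rel_setD1[OF a] by blast
    then obtain s'' where "s'' \<in> children v" "teq s' s''" using rel_setD1[OF b] by blast
    then show "\<exists>y\<in>children v. teq s y" using 1(1)[OF s] s' by blast
  next
    fix s'' assume "s'' \<in> children v"
    then obtain s' where s': "s' \<in> children u" "teq s' s''" using rel_setD2[OF b] by blast
    then obtain s where "s \<in> children t" "teq s s'" using rel_setD2[OF a] by blast
    then show "\<exists>x\<in>children t. teq x s''" using 1(1) s' by blast
  qed
qed

quotient_type 'k hset = "'k tree" / teq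
  by (rule equivpI) (auto simp: reflp_def symp_def transp_def teq_refl intro: teq_sym teq_trans)

definition elts :: "'k hset \<Rightarrow> 'k hset set" where
  "elts x = abs_hset ` children (rep_hset x)"

lemma teq_rep_abs: "teq (rep_hset (abs_hset t)) t"
  by (rule Quotient3_rep_abs[OF Quotient3_hset]) (rule teq_refl)

lemma abs_hset_eq_iff: "abs_hset t = abs_hset u \<longleftrightarrow> teq t u"
  using Quotient3_rel[OF Quotient3_hset] teq_refl by blast

lemma abs_rep_hset: "abs_hset (rep_hset x) = x"
  by (rule Quotient3_abs_rep[OF Quotient3_hset])

lemma image_abs_hset_eq_iff:
  "abs_hset ` A = abs_hset ` B \<longleftrightarrow> rel_set teq A B"
proof
  assume eq: "abs_hset ` A = abs_hset ` B"
  show "rel_set teq A B"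
  proof (rule rel_setI)
    fix s assume "s \<in> A"
    then have "abs_hset s \<in> abs_hset ` B" using eq by blast
    then show "\<exists>t\<in>B. teq s t" by (auto simp: abs_hset_eq_iff)
  next
    fix t assume "t \<in> B"
    then have "abs_hset t \<in> abs_hset ` A" using eq by blast
    then obtain s where "s \<in> A" "abs_hset t = abs_hset s" by blast
    then show "\<exists>s\<in>A. teq s t" using teq_sym by (auto simp: abs_hset_eq_iff)
  qed
next
  assume r: "rel_set teq A B"
  show "abs_hset ` A = abs_hset ` B"
  proof (intro equalityI subsetI)
    fix x assume "x \<in> abs_hset ` A"
    then obtain s where s: "s \<in> A" "x = abs_hset s" by blast
    from rel_setD1[OF r s(1)] obtain t where "t \<in> B" "teq s t" by blast
    then show "x \<in> abs_hset ` B" using s(2) abs_hset_eq_iff[of s t] by simp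
  next
    fix x assume "x \<in> abs_hset ` B"
    then obtain t where t: "t \<in> B" "x = abs_hset t" by blast
    from rel_setD2[OF r t(1)] obtain s where "s \<in> A" "teq s t" by blast
    then show "x \<in> abs_hset ` A" using t(2) abs_hset_eq_iff[of s t] by (metis imageI)
  qed
qed

lemma elts_abs: "elts (abs_hset t) = abs_hset ` children t"
  unfolding elts_def image_abs_hset_eq_iff by (rule teq_iff[THEN iffD1, OF teq_rep_abs])

lemma hset_ext: "elts x = elts y \<longleftrightarrow> x = y"
proof
  assume "elts x = elts y"
  then have "teq (rep_hset x) (rep_hset y)"
    unfolding elts_def image_abs_hset_eq_iff by (rule teqI)
  then show "x = y" using abs_hset_eq_iff abs_rep_hset by metis
qed simp

lemma ex_hset_iff:
  fixes A :: "'k hset set"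
  shows "(\<exists>x. elts x = A) \<longleftrightarrow> |A| \<le>o |UNIV :: ('k + nat) set|"
proof
  assume "\<exists>x. elts x = A"
  then obtain x where x: "elts x = A" by blast
  obtain f where f: "rep_hset x = Node f" by (cases "rep_hset x")
  have "A = abs_hset ` the ` f ` {i. f i \<noteq> None}"
  proof (intro equalityI subsetI)
    fix a assume "a \<in> A"
    then obtain s where s: "s \<in> children (Node f)" "a = abs_hset s"
      using x unfolding elts_def f by blast
    then obtain i where i: "f i = Some s" by auto
    then have "a = abs_hset (the (f i))" using s(2) by simp
    moreover have "i \<in> {i. f i \<noteq> None}" using i by simp
    ultimately show "a \<in> abs_hset ` the ` f ` {i. f i \<noteq> None}" by blast
  next
    fix a assume "a \<in> abs_hset ` the ` f ` {i. f i \<noteq> None}"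
    then obtain i where i: "f i \<noteq> None" "a = abs_hset (the (f i))" by blast
    then have "Some (the (f i)) = f i" by simp
    then have "the (f i) \<in> children (Node f)" by (metis children.simps mem_Collect_eq rangeI)
    then show "a \<in> A" using x i(2) unfolding elts_def f by blast
  qed
  then have "|A| \<le>o |{i. f i \<noteq> None}|"
    by (simp add: image_image card_of_image)
  also have "|{i. f i \<noteq> None}| \<le>o |UNIV :: ('k + nat) set|"
    by (rule card_of_mono1) simp
  finally (ordLeq_transitive) show "|A| \<le>o |UNIV :: ('k + nat) set|" .
next
  assume "|A| \<le>o |UNIV :: ('k + nat) set|"
  then obtain g :: "'k hset \<Rightarrow> 'k + nat" where g: "inj_on g A"
    unfolding card_of_ordLeq[symmetric] by blast
  define f where "f i = (if i \<in> g ` A then Some (rep_hset (inv_into A g i)) else None)" for i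
  have "children (Node f) = rep_hset ` A"
  proof (intro equalityI subsetI)
    fix t assume "t \<in> children (Node f)"
    then obtain i where "Some t = f i" by auto
    then have "i \<in> g ` A" and t: "t = rep_hset (inv_into A g i)"
      unfolding f_def by (auto split: if_splits)
    then have "inv_into A g i \<in> A" by (intro inv_into_into)
    then show "t \<in> rep_hset ` A" unfolding t by (rule imageI)
  next
    fix t assume "t \<in> rep_hset ` A"
    then obtain a where a: "a \<in> A" "t = rep_hset a" by blast
    then have "f (g a) = Some t" unfolding f_def using g by simp
    then have "Some t \<in> range f" by (metis rangeI)
    then show "t \<in> children (Node f)" by simp
  qed
  then have "elts (abs_hset (Node f)) = A"
    by (simp add: elts_abs image_image abs_rep_hset del: children.simps)
  then show "\<exists>x. elts x = A" by blast
qed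

definition hmem_rel :: "('k hset \<times> 'k hset) set" where
  "hmem_rel = {(x, y). x \<in> elts y}"

lemma wf_hmem_rel: "wf hmem_rel"
proof (rule wfUNIVI)
  fix P :: "'k hset \<Rightarrow> bool" and x
  assume step: "\<forall>x. (\<forall>y. (y, x) \<in> hmem_rel \<longrightarrow> P y) \<longrightarrow> P x"
  have "P (abs_hset t)" for t
    by (induction t rule: tree_children_induct)
      (rule step[rule_format], auto simp: hmem_rel_def elts_abs)
  then show "P x" using abs_rep_hset by metis
qed

text \<open>The set with a given extension; meaningful if the extension is not too large.\<close>

definition hset_of :: "'k hset set \<Rightarrow> 'k hset" where
  "hset_of A = (THE x. elts x = A)"

lemma elts_hset_of:
  fixes A :: "'k hset set"
  assumes "|A| \<le>o |UNIV :: ('k + nat) set|"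
  shows "elts (hset_of A) = A"
proof -
  have "\<exists>!x. elts x = A" using assms ex_hset_iff[of A] hset_ext by metis
  then show ?thesis unfolding hset_of_def by (rule theI')
qed

lemma elts_hset_of_finite:
  fixes A :: "'k hset set"
  assumes "finite A"
  shows "elts (hset_of A) = A"
proof (rule elts_hset_of)
  have "|A| <o natLeq" using assms by (simp only: finite_iff_ordLess_natLeq)
  moreover have "natLeq \<le>o |UNIV :: ('k + nat) set|"
    using infinite_iff_natLeq_ordLeq[of "UNIV :: ('k + nat) set"]
    by simp
  ultimately show "|A| \<le>o |UNIV :: ('k + nat) set|"
    using ordLess_imp_ordLeq[OF ordLess_ordLeq_trans] by blast
qed

definition opair :: "'k hset \<Rightarrow> 'k hset \<Rightarrow> 'k hset" where
  "opair x y = hset_of {hset_of {x}, hset_of {x, y}}"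

primrec hnat :: "nat \<Rightarrow> 'k hset" where
  "hnat 0 = hset_of {}"
| "hnat (Suc n) = hset_of (insert (hnat n) (elts (hnat n)))"

definition hrel :: "'k hset \<Rightarrow> ('k hset \<times> 'k hset) set" where
  "hrel r = {(x, y). opair x y \<in> elts r}"

definition tc :: "'k hset \<Rightarrow> 'k hset set" where
  "tc x = {y. (y, x) \<in> hmem_rel\<^sup>+}"

text \<open>
  For an infinite cardinal \<open>\<kappa>\<close> carried by the type \<open>'k\<close>, \<open>H_succ \<kappa>\<close> is the full $H_{\kappa^+}$:
  every set whose transitive closure has at most \<open>\<kappa>\<close> elements is represented in \<open>'k hset\<close>.
\<close>

definition H_succ :: "'k rel \<Rightarrow> 'k hset set" where
  "H_succ \<kappa> = {x. |tc x| \<le>o \<kappa>}"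


section \<open>Transitive models of ZFC without power set\<close>

datatype fm = Mem nat nat | Equal nat nat | Neg fm | Conj fm fm | All nat fm

primrec sat :: "'k hset set \<Rightarrow> (nat \<Rightarrow> 'k hset) \<Rightarrow> fm \<Rightarrow> bool" where
  "sat M e (Mem i j) \<longleftrightarrow> e i \<in> elts (e j)"
| "sat M e (Equal i j) \<longleftrightarrow> e i = e j"
| "sat M e (Neg \<phi>) \<longleftrightarrow> \<not> sat M e \<phi>"
| "sat M e (Conj \<phi> \<psi>) \<longleftrightarrow> sat M e \<phi> \<and> sat M e \<psi>"
| "sat M e (All i \<phi>) \<longleftrightarrow> (\<forall>a\<in>M. sat M (e(i := a)) \<phi>)"

definition transitive_set :: "'k hset set \<Rightarrow> bool" where
  "transitive_set M \<longleftrightarrow> (\<forall>x\<in>M. elts x \<subseteq> M)"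

text \<open>
  The axioms relativised to a transitive \<open>M\<close>. In the two schemes, the variables 0 and 1 are the
  distinguished ones and all other variables are parameters from \<open>M\<close>. Choice is the
  well-ordering principle, as is usual without power set; the Kuratowski pairs occurring in it
  are absolute for \<open>M\<close>, and minimal elements are required only for subsets lying in \<open>M\<close>.
\<close>

definition transitive_ZFC_minus_model :: "'k hset set \<Rightarrow> bool" where
  "transitive_ZFC_minus_model M \<longleftrightarrow>
     transitive_set M \<and>
     \<comment> \<open>extensionality\<close>
     (\<forall>x\<in>M. \<forall>y\<in>M. (\<forall>z\<in>M. z \<in> elts x \<longleftrightarrow> z \<in> elts y) \<longrightarrow> x = y) \<and>
     \<comment> \<open>foundation\<close>
     (\<forall>x\<in>M. (\<exists>y\<in>M. y \<in> elts x) \<longrightarrow>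
        (\<exists>y\<in>M. y \<in> elts x \<and> \<not> (\<exists>z\<in>M. z \<in> elts x \<and> z \<in> elts y))) \<and>
     \<comment> \<open>pairing\<close>
     (\<forall>x\<in>M. \<forall>y\<in>M. \<exists>z\<in>M. \<forall>w\<in>M. w \<in> elts z \<longleftrightarrow> w = x \<or> w = y) \<and>
     \<comment> \<open>union\<close>
     (\<forall>x\<in>M. \<exists>u\<in>M. \<forall>z\<in>M. z \<in> elts u \<longleftrightarrow> (\<exists>y\<in>M. y \<in> elts x \<and> z \<in> elts y)) \<and>
     \<comment> \<open>infinity\<close>
     (\<exists>w\<in>M. (\<exists>x\<in>M. x \<in> elts w \<and> (\<forall>z\<in>M. z \<notin> elts x)) \<and>
        (\<forall>x\<in>M. x \<in> elts w \<longrightarrow>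
           (\<exists>y\<in>M. y \<in> elts w \<and> (\<forall>z\<in>M. z \<in> elts y \<longleftrightarrow> z \<in> elts x \<or> z = x)))) \<and>
     \<comment> \<open>separation\<close>
     (\<forall>\<phi> e. range e \<subseteq> M \<longrightarrow> (\<forall>a\<in>M. \<exists>b\<in>M. \<forall>x\<in>M.
        x \<in> elts b \<longleftrightarrow> x \<in> elts a \<and> sat M (e(0 := x)) \<phi>)) \<and>
     \<comment> \<open>collection\<close>
     (\<forall>\<phi> e. range e \<subseteq> M \<longrightarrow> (\<forall>a\<in>M.
        (\<forall>x\<in>M. x \<in> elts a \<longrightarrow> (\<exists>y\<in>M. sat M (e(0 := x, 1 := y)) \<phi>)) \<longrightarrow>
        (\<exists>b\<in>M. \<forall>x\<in>M. x \<in> elts a \<longrightarrow>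
           (\<exists>y\<in>M. y \<in> elts b \<and> sat M (e(0 := x, 1 := y)) \<phi>)))) \<and>
     \<comment> \<open>choice\<close>
     (\<forall>a\<in>M. \<exists>r\<in>M. linear_order_on (elts a) (hrel r) \<and>
        (\<forall>s\<in>M. elts s \<subseteq> elts a \<and> elts s \<noteq> {} \<longrightarrow>
           (\<exists>m\<in>elts s. \<forall>x\<in>elts s. (m, x) \<in> hrel r)))"


section \<open>Forcing\<close>

text \<open>
  A forcing order on a set \<open>Q\<close> is given by its relation \<open>r\<close>, where \<open>(p, q) \<in> r\<close> means that
  \<open>p\<close> is stronger than \<open>q\<close>.
\<close>

definition dense_in :: "'a set \<Rightarrow> 'a rel \<Rightarrow> 'a set \<Rightarrow> bool" where
  "dense_in Q r D \<longleftrightarrow> D \<subseteq> Q \<and> (\<forall>p\<in>Q. \<exists>d\<in>D. (d, p) \<in> r)"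

definition filter_on :: "'a set \<Rightarrow> 'a rel \<Rightarrow> 'a set \<Rightarrow> bool" where
  "filter_on Q r F \<longleftrightarrow> F \<subseteq> Q \<and> F \<noteq> {} \<and>
     (\<forall>p\<in>F. \<forall>q\<in>Q. (p, q) \<in> r \<longrightarrow> q \<in> F) \<and>
     (\<forall>p\<in>F. \<forall>q\<in>F. \<exists>s\<in>F. (s, p) \<in> r \<and> (s, q) \<in> r)"

definition compatible :: "'a set \<Rightarrow> 'a rel \<Rightarrow> 'a \<Rightarrow> 'a \<Rightarrow> bool" where
  "compatible Q r p q \<longleftrightarrow> (\<exists>s\<in>Q. (s, p) \<in> r \<and> (s, q) \<in> r)"

definition strong_antichain :: "'a set \<Rightarrow> 'a rel \<Rightarrow> 'a set \<Rightarrow> bool" where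
  "strong_antichain Q r A \<longleftrightarrow> A \<subseteq> Q \<and> (\<forall>p\<in>A. \<forall>q\<in>A. p \<noteq> q \<longrightarrow> \<not> compatible Q r p q)"

definition ccc :: "'a set \<Rightarrow> 'a rel \<Rightarrow> bool" where
  "ccc Q r \<longleftrightarrow> (\<forall>A. strong_antichain Q r A \<longrightarrow> countable A)"

text \<open>A poset as an element of the universe of sets is an ordered pair \<open>opair Q R\<close>.\<close>

definition poset :: "'k hset \<Rightarrow> 'k hset \<Rightarrow> bool" where
  "poset Q R \<longleftrightarrow> elts Q \<noteq> {} \<and> elts R \<subseteq> {opair p q |p q. p \<in> elts Q \<and> q \<in> elts Q} \<and>
     partial_order_on (elts Q) (hrel R)"

text \<open>\<open>f\<close> is the graph of an injection \<open>g\<close> from \<open>A\<close> into the von Neumann natural numbers.\<close>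

definition countable_in :: "'k hset set \<Rightarrow> 'k hset \<Rightarrow> bool" where
  "countable_in M A \<longleftrightarrow> (\<exists>f\<in>M. \<exists>g :: 'k hset \<Rightarrow> nat.
     inj_on g (elts A) \<and> elts f = (\<lambda>x. opair x (hnat (g x))) ` elts A)"

definition ccc_in :: "'k hset set \<Rightarrow> 'k hset \<Rightarrow> 'k hset \<Rightarrow> bool" where
  "ccc_in M Q R \<longleftrightarrow>
     (\<forall>A\<in>M. strong_antichain (elts Q) (hrel R) (elts A) \<longrightarrow> countable_in M A)"

definition generic :: "'k hset set \<Rightarrow> 'k hset \<Rightarrow> 'k hset \<Rightarrow> 'k hset set \<Rightarrow> bool" where
  "generic M Q R G \<longleftrightarrow> filter_on (elts Q) (hrel R) G \<and>
     (\<forall>D\<in>M. dense_in (elts Q) (hrel R) (elts D) \<longrightarrow> G \<inter> elts D \<noteq> {})"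

inductive forcing_name :: "'k hset \<Rightarrow> 'k hset \<Rightarrow> bool" for Q where
  "(\<forall>z\<in>elts \<tau>. \<exists>\<sigma> p. z = opair \<sigma> p \<and> p \<in> elts Q \<and> forcing_name Q \<sigma>) \<Longrightarrow> forcing_name Q \<tau>"

lemma opair_elts_trancl:
  assumes "opair \<sigma> p \<in> elts \<tau>"
  shows "(\<sigma>, \<tau>) \<in> hmem_rel\<^sup>+"
proof -
  have "(\<sigma>, hset_of {\<sigma>}) \<in> hmem_rel" and "(hset_of {\<sigma>}, opair \<sigma> p) \<in> hmem_rel"
    and "(opair \<sigma> p, \<tau>) \<in> hmem_rel"
    using assms by (simp_all add: hmem_rel_def opair_def elts_hset_of_finite)
  then show ?thesis by (blast intro: r_into_trancl trancl_into_trancl)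
qed

function name_val :: "'k hset set \<Rightarrow> 'k hset \<Rightarrow> 'k hset" where
  "name_val G \<tau> = hset_of (name_val G ` {\<sigma>. \<exists>p\<in>G. opair \<sigma> p \<in> elts \<tau>})"
  by auto
termination
  by (relation "inv_image (hmem_rel\<^sup>+) snd")
    (auto intro: wf_trancl wf_hmem_rel opair_elts_trancl)

declare name_val.simps [simp del]

definition generic_extension :: "'k hset set \<Rightarrow> 'k hset \<Rightarrow> 'k hset set \<Rightarrow> 'k hset set" where
  "generic_extension M Q G = name_val G ` {\<tau> \<in> M. forcing_name Q \<tau>}"

definition ccc_forcing_extension :: "'k hset set \<Rightarrow> 'k hset set \<Rightarrow> bool" where
  "ccc_forcing_extension M N \<longleftrightarrow> (\<exists>Q R G. opair Q R \<in> M \<and> poset Q R \<and> ccc_in M Q R \<and>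
     generic M Q R G \<and> N = generic_extension M Q G)"


section \<open>The local grounded Martin's Axiom\<close>

abbreviation continuum :: "real rel" where
  "continuum \<equiv> |UNIV :: real set|"

text \<open>
  The argument fixes a bound on the cardinals \<open>\<kappa>\<close> considered. The axiom proper says that
  \<open>local_grMA TYPE('k)\<close> holds for some type \<open>'k\<close>; as a hypothesis of a theorem, this existential
  quantifier over types is a type variable that occurs only in the hypothesis.
\<close>

definition local_grMA :: "'k itself \<Rightarrow> bool" where
  "local_grMA _ \<longleftrightarrow> (\<exists>(\<kappa> :: 'k rel) (M :: 'k hset set).
     Card_order \<kappa> \<and> continuum \<le>o \<kappa> \<and>
     M \<subseteq> H_succ \<kappa> \<and> transitive_ZFC_minus_model M \<and>
     ccc_forcing_extension M (H_succ \<kappa>) \<and>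
     (\<forall>Q R. opair Q R \<in> M \<and> poset Q R \<and> ccc (elts Q) (hrel R) \<longrightarrow>
        (\<forall>\<D>. |\<D>| <o continuum \<and> (\<forall>D\<in>\<D>. dense_in (elts Q) (hrel R) D) \<longrightarrow>
           (\<exists>F. filter_on (elts Q) (hrel R) F \<and> (\<forall>D\<in>\<D>. F \<inter> D \<noteq> {})))))"


section \<open>Cardinal characteristics\<close>

text \<open>The least cardinality of a set with property \<open>P\<close>.\<close>

definition least_card :: "('a set \<Rightarrow> bool) \<Rightarrow> 'a rel" where
  "least_card P = |SOME A. P A \<and> (\<forall>B. P B \<longrightarrow> |A| \<le>o |B| )|"

lemma least_card:
  assumes "P A\<^sub>0"
  shows "\<exists>A. P A \<and> least_card P = |A|" and "P B \<Longrightarrow> least_card P \<le>o |B|"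
proof -
  have "\<exists>r\<in>card_of ` Collect P. \<forall>r'\<in>card_of ` Collect P. r \<le>o r'"
    by (rule exists_minim_Card_order) (use assms card_of_Card_order in auto)
  then have ex: "\<exists>A. P A \<and> (\<forall>B. P B \<longrightarrow> |A| \<le>o |B| )" by auto
  from someI_ex[OF ex] show "\<exists>A. P A \<and> least_card P = |A|" "P B \<Longrightarrow> least_card P \<le>o |B|"
    unfolding least_card_def by blast+
qed

definition meagre_sets :: "real set set" where
  "meagre_sets = {\<Union>n. N n |N :: nat \<Rightarrow> real set. \<forall>n. interior (closure (N n)) = {}}"

abbreviation null_ideal :: "real set set" where
  "null_ideal \<equiv> null_sets lebesgue"

definition cov :: "real set set \<Rightarrow> real set rel" where
  "cov I = least_card (\<lambda>F. F \<subseteq> I \<and> \<Union>F = UNIV)"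

definition non :: "real set set \<Rightarrow> real rel" where
  "non I = least_card (\<lambda>A. A \<notin> I)"

definition cof :: "real set set \<Rightarrow> real set rel" where
  "cof I = least_card (\<lambda>F. F \<subseteq> I \<and> (\<forall>A\<in>I. \<exists>B\<in>F. A \<subseteq> B))"

definition dominating_number :: "(nat \<Rightarrow> nat) rel" where
  "dominating_number =
     least_card (\<lambda>F. \<forall>f :: nat \<Rightarrow> nat. \<exists>g\<in>F. \<forall>\<^sub>F n in sequentially. f n \<le> g n)"

definition splits :: "nat set \<Rightarrow> nat set \<Rightarrow> bool" where
  "splits y x \<longleftrightarrow> infinite (x \<inter> y) \<and> infinite (x - y)"

definition reaping_number :: "nat set rel" where
  "reaping_number =
     least_card (\<lambda>R. (\<forall>x\<in>R. infinite x) \<and> \<not> (\<exists>y. \<forall>x\<in>R. splits y x))"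

end

theory Submission
  imports Defs
begin

text \<open>
  Every transitive model of ZFC without power set contains a copy of Cohen forcing, here the finite
  sets of natural numbers ordered by end-extension. This poset is countable, hence ccc in the
  universe, so the local grounded Martin's Axiom yields generic filters for fewer than continuum
  many dense sets of Cohen forcing, and therefore of every countable order. Cohen reals avoid
  fewer than continuum many meagre sets, are undominated and splitting, and code null sets covering
  fewer than continuum many reals. This gives all the lower bounds, the one for the cofinality of
  the null ideal after picking a point outside each member of the family.
\<close>

section \<open>Cohen forcing in a transitive model\<close>

text \<open>The order has to be an element of a model without power set that is accessible only
  through explicit formulas. Finite sets of naturals suit this: a condition is a subset of a von
  Neumann numeral, and since numerals are ordered by membership, end-extension can be expressed
  without functions or finite sequences inside the model. As a numeral has only finitely many
  subsets, collection along omega replaces the power set. End-extension, and not mere inclusion,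
  makes this Cohen forcing: the conditions form the tree of finite strictly increasing sequences,
  whereas under inclusion any two finite sets would be compatible. Only this one order is built in
  the model; closed rational intervals and finite lists are reached from it outside, by a walk
  steered by the conditions, so that no further forcing has to be defined by formulas.\<close>

definition Imp_fm :: "fm \<Rightarrow> fm \<Rightarrow> fm" where
  "Imp_fm \<phi> \<psi> = Neg (Conj \<phi> (Neg \<psi>))"

definition Iff_fm :: "fm \<Rightarrow> fm \<Rightarrow> fm" where
  "Iff_fm \<phi> \<psi> = Conj (Imp_fm \<phi> \<psi>) (Imp_fm \<psi> \<phi>)"

definition Ex_fm :: "nat \<Rightarrow> fm \<Rightarrow> fm" where
  "Ex_fm i \<phi> = Neg (All i (Neg \<phi>))"

lemma sat_connectives [simp]:
  "sat M e (Imp_fm \<phi> \<psi>) \<longleftrightarrow> (sat M e \<phi> \<longrightarrow> sat M e \<psi>)"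
  "sat M e (Iff_fm \<phi> \<psi>) \<longleftrightarrow> (sat M e \<phi> \<longleftrightarrow> sat M e \<psi>)"
  "sat M e (Ex_fm i \<phi>) \<longleftrightarrow> (\<exists>a\<in>M. sat M (e(i := a)) \<phi>)"
  by (auto simp: Imp_fm_def Iff_fm_def Ex_fm_def)

section \<open>Numerals and ordered pairs as sets\<close>

lemma hmem_irrefl: "x \<notin> elts x"
  using wf_not_refl[OF wf_hmem_rel, of x] by (auto simp: hmem_rel_def)

lemma elts_hnat: "elts (hnat n) = hnat ` {..<n}"
  by (induction n) (auto simp: elts_hset_of_finite lessThan_Suc)

declare hnat.simps [simp del]

lemma hnat_mem_iff [simp]: "hnat m \<in> elts (hnat n) \<longleftrightarrow> m < n"
proof
  assume "hnat m \<in> elts (hnat n)"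
  then show "m < n"
  proof (rule contrapos_pp)
    assume "\<not> m < n"
    then have "elts (hnat n) \<subseteq> elts (hnat m)" by (force simp: elts_hnat)
    then show "hnat m \<notin> elts (hnat n)" using hmem_irrefl by blast
  qed
qed (auto simp: elts_hnat)

lemma inj_hnat: "inj hnat"
  by (rule injI) (metis hnat_mem_iff less_irrefl linorder_neqE_nat)

text \<open>This finiteness bounds the sections in the collection arguments and makes the set of
  conditions countable.\<close>

lemma finite_subsets_hnat: "finite {z :: 'k hset. elts z \<subseteq> elts (hnat n)}"
proof (rule finite_imageD)
  have "elts ` {z :: 'k hset. elts z \<subseteq> elts (hnat n)} \<subseteq> Pow (elts (hnat n))" by blast
  then show "finite (elts ` {z :: 'k hset. elts z \<subseteq> elts (hnat n)})"
    by (rule finite_subset) (simp add: elts_hnat)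
  show "inj_on elts {z :: 'k hset. elts z \<subseteq> elts (hnat n)}" by (simp add: inj_on_def hset_ext)
qed

lemma opair_eq_iff [simp]: "opair a b = opair c d \<longleftrightarrow> a = c \<and> b = d"
proof
  have fin: "elts (hset_of {x, y}) = {x, y}" "elts (hset_of {x}) = {x}" for x y :: "'a hset"
    by (simp_all add: elts_hset_of_finite)
  assume "opair a b = opair c d"
  then have "{hset_of {a}, hset_of {a, b}} = {hset_of {c}, hset_of {c, d}}"
    unfolding opair_def by (metis fin(1))
  then have "elts ` {hset_of {a}, hset_of {a, b}} = elts ` {hset_of {c}, hset_of {c, d}}"
    by simp
  then have "{{a}, {a, b}} = {{c}, {c, d}}" by (simp only: image_insert image_empty fin)
  then show "a = c \<and> b = d" by (auto simp: doubleton_eq_iff)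
qed simp

lemma eq_opair_iff:
  "z = opair x y \<longleftrightarrow> elts z = {hset_of {x}, hset_of {x, y}}"
  unfolding opair_def
  by (metis elts_hset_of_finite finite.emptyI finite_insert hset_ext)

section \<open>The axioms of the model in absolute form\<close>

locale zfc_minus =
  fixes M :: "'k hset set"
  assumes model: "transitive_ZFC_minus_model M"
begin

lemma trans_M: "x \<in> M \<Longrightarrow> y \<in> elts x \<Longrightarrow> y \<in> M"
proof -
  have "transitive_set M"
    using model unfolding transitive_ZFC_minus_model_def by (elim conjE)
  then show "x \<in> M \<Longrightarrow> y \<in> elts x \<Longrightarrow> y \<in> M"
    unfolding transitive_set_def by blast
qed

text \<open>Transitivity removes the relativisation: all elements of \<open>z\<close> lie in
  \<open>M\<close>, so an axiom that fixes \<open>z\<close> within \<open>M\<close> fixes its true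
  extension.\<close>

lemma elts_eq_iff: "z \<in> M \<Longrightarrow> A \<subseteq> M \<Longrightarrow> (\<forall>w\<in>M. w \<in> elts z \<longleftrightarrow> w \<in> A) \<longleftrightarrow> elts z = A"
  using trans_M by blast

lemma pairing:
  assumes "x \<in> M" "y \<in> M"
  shows "\<exists>z\<in>M. elts z = {x, y}"
proof -
  have "\<forall>x\<in>M. \<forall>y\<in>M. \<exists>z\<in>M. \<forall>w\<in>M. w \<in> elts z \<longleftrightarrow> w = x \<or> w = y"
    using model unfolding transitive_ZFC_minus_model_def by (elim conjE)
  then obtain z where "z \<in> M" "\<forall>w\<in>M. w \<in> elts z \<longleftrightarrow> w = x \<or> w = y"
    using assms by blast
  then show ?thesis using elts_eq_iff[of z "{x, y}"] assms by blast
qed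

lemma union:
  assumes x: "x \<in> M"
  shows "\<exists>u\<in>M. elts u = \<Union> (elts ` elts x)"
proof -
  have "\<forall>x\<in>M. \<exists>u\<in>M. \<forall>z\<in>M. z \<in> elts u \<longleftrightarrow> (\<exists>y\<in>M. y \<in> elts x \<and> z \<in> elts y)"
    using model unfolding transitive_ZFC_minus_model_def by (elim conjE)
  then obtain u where u: "u \<in> M" "\<forall>z\<in>M. z \<in> elts u \<longleftrightarrow> (\<exists>y\<in>M. y \<in> elts x \<and> z \<in> elts y)"
    using x by blast
  have "elts u = \<Union> (elts ` elts x)"
  proof (intro equalityI subsetI)
    fix z assume "z \<in> elts u"
    then show "z \<in> \<Union> (elts ` elts x)" using u trans_M by blast
  next
    fix z assume "z \<in> \<Union> (elts ` elts x)"
    then obtain y where y: "y \<in> elts x" "z \<in> elts y" by blast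
    then have "y \<in> M" "z \<in> M" using x trans_M by blast+
    then show "z \<in> elts u" using u y by blast
  qed
  then show ?thesis using u by blast
qed

lemma infinity:
  "\<exists>w\<in>M. (\<exists>x\<in>M. x \<in> elts w \<and> (\<forall>z\<in>M. z \<notin> elts x)) \<and>
     (\<forall>x\<in>M. x \<in> elts w \<longrightarrow>
        (\<exists>y\<in>M. y \<in> elts w \<and> (\<forall>z\<in>M. z \<in> elts y \<longleftrightarrow> z \<in> elts x \<or> z = x)))"
  using model unfolding transitive_ZFC_minus_model_def by (elim conjE)

lemma separation:
  assumes "range e \<subseteq> M" "a \<in> M"
  shows "\<exists>b\<in>M. elts b = {x \<in> elts a. sat M (e(0 := x)) \<phi>}"
proof -
  have "\<forall>\<phi> e. range e \<subseteq> M \<longrightarrow> (\<forall>a\<in>M. \<exists>b\<in>M. \<forall>x\<in>M.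
        x \<in> elts b \<longleftrightarrow> x \<in> elts a \<and> sat M (e(0 := x)) \<phi>)"
    using model unfolding transitive_ZFC_minus_model_def by (elim conjE)
  from this[rule_format, OF assms] obtain b where
    b: "b \<in> M" "\<forall>x\<in>M. x \<in> elts b \<longleftrightarrow> x \<in> elts a \<and> sat M (e(0 := x)) \<phi>" by blast
  then have "elts b = {x \<in> elts a. sat M (e(0 := x)) \<phi>}"
    using trans_M[OF assms(2)] trans_M[OF b(1)] by blast
  then show ?thesis using b(1) by blast
qed

lemma collection:
  assumes "range e \<subseteq> M" "a \<in> M"
    and "\<And>x. x \<in> elts a \<Longrightarrow> \<exists>y\<in>M. sat M (e(0 := x, 1 := y)) \<phi>"
  shows "\<exists>b\<in>M. \<forall>x\<in>elts a. \<exists>y\<in>elts b. sat M (e(0 := x, 1 := y)) \<phi>"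
proof -
  have "\<forall>\<phi> e. range e \<subseteq> M \<longrightarrow> (\<forall>a\<in>M.
        (\<forall>x\<in>M. x \<in> elts a \<longrightarrow> (\<exists>y\<in>M. sat M (e(0 := x, 1 := y)) \<phi>)) \<longrightarrow>
        (\<exists>b\<in>M. \<forall>x\<in>M. x \<in> elts a \<longrightarrow>
           (\<exists>y\<in>M. y \<in> elts b \<and> sat M (e(0 := x, 1 := y)) \<phi>)))"
    using model unfolding transitive_ZFC_minus_model_def by (elim conjE)
  from this[rule_format, OF assms(1,2)] assms(3) obtain b where
    "b \<in> M" "\<forall>x\<in>M. x \<in> elts a \<longrightarrow> (\<exists>y\<in>M. y \<in> elts b \<and> sat M (e(0 := x, 1 := y)) \<phi>)" by blast
  then show ?thesis using trans_M[OF assms(2)] by blast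
qed

text \<open>A further element costs two pairings and a union: \<open>{a}\<close>, then the pair of
  \<open>x\<close> and \<open>{a}\<close>. Finiteness is meant outside the model, so finite
  witnesses can be described freely and need no formula.\<close>

lemma finite_subset_mem:
  assumes "finite A" "A \<subseteq> M"
  shows "hset_of A \<in> M"
proof -
  have "\<exists>x\<in>M. elts x = A" using assms
  proof (induction A)
    case empty
    have "\<exists>x\<in>M. \<forall>z\<in>M. z \<notin> elts x"
      using infinity by blast
    then show ?case using trans_M by blast
  next
    case (insert a A)
    then obtain x where x: "x \<in> M" "elts x = A" by auto
    obtain y where y: "y \<in> M" "elts y = {a, a}" using pairing insert by blast
    obtain z where z: "z \<in> M" "elts z = {x, y}" using pairing x y by blast
    obtain u where "u \<in> M" "elts u = \<Union> (elts ` elts z)" using union z by blast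
    then show ?case using x y z by auto
  qed
  then show ?thesis using elts_hset_of_finite[OF assms(1)] hset_ext by metis
qed

lemma opair_mem: "x \<in> M \<Longrightarrow> y \<in> M \<Longrightarrow> opair x y \<in> M"
  unfolding opair_def by (intro finite_subset_mem) (auto intro: finite_subset_mem)

lemma hnat_mem: "hnat n \<in> M"
proof (induction n)
  case (Suc n)
  have "insert (hnat n) (elts (hnat n)) \<subseteq> M" using Suc trans_M by blast
  then show ?case unfolding hnat.simps by (intro finite_subset_mem) (simp_all add: elts_hnat)
qed (simp add: finite_subset_mem hnat.simps)

text \<open>A number is recognised by a condition on the predecessors below it; no transitivity or
  linearity needs to be stated because membership is well-founded.\<close>

lemma ex_omega: "\<exists>w\<in>M. elts w = range hnat"
proof -
  obtain w where "w \<in> M" and zero: "\<exists>x\<in>M. x \<in> elts w \<and> (\<forall>z\<in>M. z \<notin> elts x)"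
    and suc: "\<forall>x\<in>M. x \<in> elts w \<longrightarrow>
           (\<exists>y\<in>M. y \<in> elts w \<and> (\<forall>z\<in>M. z \<in> elts y \<longleftrightarrow> z \<in> elts x \<or> z = x))"
    by (rule bexE[OF infinity], erule conjE, rule that)
  from this(1) zero obtain x0 where
    w: "w \<in> M" "x0 \<in> M" "x0 \<in> elts w" "\<forall>z\<in>M. z \<notin> elts x0" by blast
  have hnat_w: "hnat n \<in> elts w" for n
  proof (induction n)
    case 0
    have "elts x0 = {}" using w(2,4) trans_M by blast
    then have "elts x0 = elts (hnat 0)" by (simp add: elts_hnat)
    then show ?case using w(3) hset_ext[of x0 "hnat 0"] by simp
  next
    case (Suc n)
    then obtain y where y: "y \<in> M" "y \<in> elts w"
        "\<forall>z\<in>M. z \<in> elts y \<longleftrightarrow> z \<in> elts (hnat n) \<or> z = hnat n"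
      using suc hnat_mem by blast
    then have "elts y = insert (hnat n) (elts (hnat n))"
      using elts_eq_iff[of y "insert (hnat n) (elts (hnat n))"] hnat_mem trans_M by blast
    then have "elts y = elts (hnat (Suc n))" by (simp add: elts_hnat lessThan_Suc)
    then show ?case using y(2) hset_ext[of y "hnat (Suc n)"] by simp
  qed
  define N where "N x \<longleftrightarrow> (\<forall>y\<in>insert x (elts x). elts y = {} \<or>
      (\<exists>z\<in>elts y. elts y = insert z (elts z)))" for x :: "'k hset"
  \<comment> \<open>Internal form of \<open>N\<close>: variable 1 is \<open>y\<close>, 2 its
    predecessor, and 3 runs through elements; a negated conjunction of negations is a
    disjunction.\<close>
  define \<phi> where "\<phi> = All 1 (Imp_fm (Neg (Conj (Neg (Equal 1 0)) (Neg (Mem 1 0))))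
     (Imp_fm (Ex_fm 3 (Mem 3 1)) (Ex_fm 2 (Conj (Mem 2 1)
        (All 3 (Iff_fm (Mem 3 1) (Neg (Conj (Neg (Mem 3 2)) (Neg (Equal 3 2))))))))))"
  have sat: "sat M (e(0 := x)) \<phi> \<longleftrightarrow> N x" if x: "x \<in> M" for e x
  proof -
    have 1: "(\<exists>z\<in>M. z \<in> elts y) \<longleftrightarrow> elts y \<noteq> {}" if "y \<in> M" for y using that trans_M by blast
    have 2: "(\<forall>z\<in>M. z \<in> elts y \<longleftrightarrow> z \<in> elts v \<or> z = v) \<longleftrightarrow> elts y = insert v (elts v)"
      if "y \<in> M" "v \<in> M" for y v
      using elts_eq_iff[of y "insert v (elts v)"] that trans_M by blast
    have "sat M (e(0 := x)) \<phi> \<longleftrightarrow> (\<forall>y\<in>M. y = x \<or> y \<in> elts x \<longrightarrow> elts y \<noteq> {} \<longrightarrow>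
       (\<exists>v\<in>M. v \<in> elts y \<and> elts y = insert v (elts v)))"
      unfolding \<phi>_def by (simp add: 1 2 cong: ball_cong bex_cong)
    also have "\<dots> \<longleftrightarrow> N x" unfolding N_def using x trans_M by blast
    finally show ?thesis .
  qed
  have N_hnat: "N (hnat n)" for n
    unfolding N_def
  proof
    fix y assume "y \<in> insert (hnat n) (elts (hnat n))"
    then obtain m where "y = hnat m" by (auto simp: elts_hnat)
    then show "elts y = {} \<or> (\<exists>z\<in>elts y. elts y = insert z (elts z))"
      by (cases m) (auto simp: elts_hnat lessThan_Suc)
  qed
  \<comment> \<open>The predecessor \<open>z\<close> inherits \<open>N\<close>, as \<open>z\<close>
    and its elements are elements of \<open>x\<close>; hence induction along membership
    applies.\<close>
  have N_range: "N x \<Longrightarrow> x \<in> range hnat" for x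
  proof (induction x rule: wf_induct[OF wf_hmem_rel])
    case (1 x)
    consider "elts x = {}" | z where "z \<in> elts x" "elts x = insert z (elts z)"
      using 1(2) unfolding N_def by blast
    then show ?case
    proof cases
      case 1
      then have "x = hnat 0" using hset_ext[of x "hnat 0"] by (simp add: elts_hnat)
      then show ?thesis by blast
    next
      case 2
      have "N z" using 1(2) 2(2) unfolding N_def by auto
      then obtain n where "z = hnat n" using 1(1) 2 by (auto simp: hmem_rel_def)
      then have "elts x = elts (hnat (Suc n))" using 2 by (simp add: elts_hnat lessThan_Suc)
      then show ?thesis using hset_ext by blast
    qed
  qed
  \<comment> \<open>The set given by infinity may have other elements besides the numerals;
    separation removes them. The constant assignment only supplies default values, since
    \<open>\<phi>\<close> has no free variable but 0.\<close>
  from separation[of "\<lambda>_. w" w \<phi>] w obtain b where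
    b: "b \<in> M" "elts b = {x \<in> elts w. sat M ((\<lambda>_. w)(0 := x)) \<phi>}" by auto
  have "elts b = {x \<in> elts w. N x}" unfolding b using sat trans_M w by blast
  also have "\<dots> = range hnat" using N_hnat N_range hnat_w by blast
  finally show ?thesis using b by blast
qed

text \<open>The formula speaks about \<open>x\<close> and \<open>z\<close> through the variables 0 and 2; the variables 1 and 3 are
  kept free for the bound given by collection and for the parameter \<open>a\<close>.\<close>

lemma definable_UN:
  assumes a: "a \<in> M"
    and def_P: "\<And>e. range e \<subseteq> M \<Longrightarrow> sat M e \<phi> \<longleftrightarrow> P (e 0) (e 2)"
    and fin: "\<And>x. x \<in> elts a \<Longrightarrow> finite {z \<in> M. P x z}"
  shows "\<exists>b\<in>M. elts b = {z \<in> M. \<exists>x\<in>elts a. P x z}"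
proof -
  have r: "range ((\<lambda>_. a)(0 := x, 1 := y, 2 := z)) \<subseteq> M" if "x \<in> M" "y \<in> M" "z \<in> M" for x y z
    using a that by auto
  have s1: "sat M ((\<lambda>_. a)(0 := x, 1 := y)) (All 2 (Imp_fm \<phi> (Mem 2 1)))
      \<longleftrightarrow> (\<forall>z\<in>M. P x z \<longrightarrow> z \<in> elts y)" if "x \<in> M" "y \<in> M" for x y
    using def_P[OF r[OF that]] by simp
  \<comment> \<open>Collection is applied to bounds instead of elements: for each \<open>x\<close>
    it would promise just some \<open>z\<close> with \<open>P x z\<close>, but a bound
    \<open>y\<close> contains all of them. Finiteness provides such a \<open>y\<close> in
    \<open>M\<close>.\<close>
  have "\<exists>b\<in>M. \<forall>x\<in>elts a. \<exists>y\<in>elts b.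
     sat M ((\<lambda>_. a)(0 := x, 1 := y)) (All 2 (Imp_fm \<phi> (Mem 2 1)))"
  proof (rule collection)
    fix x assume x: "x \<in> elts a"
    let ?y = "hset_of {z \<in> M. P x z}"
    have y: "?y \<in> M" by (rule finite_subset_mem) (use fin[OF x] in auto)
    moreover have "elts ?y = {z \<in> M. P x z}" by (rule elts_hset_of_finite[OF fin[OF x]])
    ultimately have "sat M ((\<lambda>_. a)(0 := x, 1 := ?y)) (All 2 (Imp_fm \<phi> (Mem 2 1)))"
      using s1[OF trans_M[OF a x] y] by simp
    then show "\<exists>y\<in>M. sat M ((\<lambda>_. a)(0 := x, 1 := y)) (All 2 (Imp_fm \<phi> (Mem 2 1)))"
      using y by blast
  qed (use a in auto)
  then obtain b where b: "b \<in> M" "\<And>x. x \<in> elts a \<Longrightarrow> \<exists>y\<in>elts b.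
     sat M ((\<lambda>_. a)(0 := x, 1 := y)) (All 2 (Imp_fm \<phi> (Mem 2 1)))" by blast
  obtain u where u: "u \<in> M" "elts u = \<Union> (elts ` elts b)" using union b by blast
  have sub: "z \<in> elts u" if z: "z \<in> M" and x: "x \<in> elts a" and P: "P x z" for x z
  proof -
    obtain y where "y \<in> elts b" "sat M ((\<lambda>_. a)(0 := x, 1 := y)) (All 2 (Imp_fm \<phi> (Mem 2 1)))"
      using b x by blast
    moreover then have "y \<in> M" using b trans_M by blast
    ultimately show ?thesis using s1[OF trans_M[OF a x]] z P u by blast
  qed
  \<comment> \<open>Separation puts the candidate into variable 0, where \<open>\<phi>\<close>
    expects \<open>x\<close>. The first quantifier copies the candidate to 2, which frees 0 for
    \<open>x\<close>; variable 3 still holds \<open>a\<close>.\<close>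
  obtain c where c: "c \<in> M" "elts c = {z \<in> elts u. sat M ((\<lambda>_. a)(0 := z))
      (Ex_fm 2 (Conj (Equal 2 0) (Ex_fm 0 (Conj (Mem 0 3) \<phi>))))}"
    using separation[of "\<lambda>_. a" u, OF _ u(1)] a by blast
  have s2: "sat M ((\<lambda>_. a)(0 := z)) (Ex_fm 2 (Conj (Equal 2 0) (Ex_fm 0 (Conj (Mem 0 3) \<phi>))))
      \<longleftrightarrow> (\<exists>x\<in>elts a. P x z)" if z: "z \<in> M" for z
  proof -
    have "sat M ((\<lambda>_. a)(2 := z, 0 := x)) \<phi> \<longleftrightarrow> P x z" if "x \<in> M" for x
      using def_P[of "(\<lambda>_. a)(2 := z, 0 := x)"] that z a by auto
    then have "(\<exists>x\<in>M. x \<in> elts a \<and> sat M ((\<lambda>_. a)(2 := z, 0 := x)) \<phi>) \<longleftrightarrow> (\<exists>x\<in>elts a. P x z)"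
      using trans_M[OF a] by blast
    moreover have "(\<lambda>_. a)(0 := z, 2 := z, 0 := x) = (\<lambda>_::nat. a)(2 := z, 0 := x)" for x
      by (simp add: fun_upd_twist[of 0 2])
    ultimately show ?thesis using z by simp
  qed
  have "elts c = {z \<in> M. \<exists>x\<in>elts a. P x z}"
    unfolding c(2) using s2 sub trans_M[OF u(1)] by blast
  then show ?thesis using c by blast
qed

end

section \<open>The conditions and their order as elements of the model\<close>

definition end_extends :: "'k hset \<Rightarrow> 'k hset \<Rightarrow> bool" where
  "end_extends p q \<longleftrightarrow> elts q \<subseteq> elts p \<and> (\<forall>a\<in>elts p - elts q. \<forall>b\<in>elts q. b \<in> elts a)"

context zfc_minus
begin

text \<open>The union runs over all numerals, each contributing its finitely many subsets; every
  such subset is finite and hence already in \<open>M\<close>.\<close>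

lemma ex_finite_subsets_omega:
  "\<exists>Q\<in>M. elts Q = {z. \<exists>n. elts z \<subseteq> elts (hnat n)}"
proof -
  obtain w where w: "w \<in> M" "elts w = range hnat" using ex_omega by blast
  have M: "z \<in> M" if "elts z \<subseteq> elts (hnat n)" for n z
  proof -
    have "finite (elts z)" using that by (rule finite_subset) (simp add: elts_hnat)
    moreover then have "z = hset_of (elts z)" using elts_hset_of_finite hset_ext by metis
    ultimately show ?thesis using finite_subset_mem that trans_M[OF hnat_mem] by (metis subset_iff)
  qed
  have "\<exists>b\<in>M. elts b = {z \<in> M. \<exists>x\<in>elts w. elts z \<subseteq> elts x}"
  proof (rule definable_UN[OF w(1)])
    fix e :: "nat \<Rightarrow> 'k hset" assume "range e \<subseteq> M"
    then show "sat M e (All 1 (Imp_fm (Mem 1 2) (Mem 1 0))) \<longleftrightarrow> elts (e 2) \<subseteq> elts (e 0)"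
      using trans_M by auto
  next
    fix x assume "x \<in> elts w"
    then show "finite {z \<in> M. elts z \<subseteq> elts x}"
      using w finite_subsets_hnat by (auto intro: rev_finite_subset)
  qed
  moreover have "{z \<in> M. \<exists>x\<in>elts w. elts z \<subseteq> elts x} = {z. \<exists>n. elts z \<subseteq> elts (hnat n)}"
    unfolding w using M by blast
  ultimately show ?thesis by simp
qed

text \<open>One numeral bounds both components of a pair, so each section is finite; for given
  \<open>p\<close> and \<open>q\<close> the larger of their bounds serves.\<close>

lemma ex_end_extension_order:
  assumes Q: "Q \<in> M" "elts Q = {z. \<exists>n. elts z \<subseteq> elts (hnat n)}"
  shows "\<exists>R\<in>M. elts R = {opair p q |p q. p \<in> elts Q \<and> q \<in> elts Q \<and> end_extends p q}"
proof -
  obtain w where w: "w \<in> M" "elts w = range hnat" using ex_omega by blast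
  define P where "P n z \<longleftrightarrow> (\<exists>p\<in>M. \<exists>q\<in>M. z = opair p q \<and> elts p \<subseteq> elts n \<and> elts q \<subseteq> elts n \<and>
    end_extends p q)" for n z :: "'k hset"
  \<comment> \<open>Variable 10 is bound here and differs from all variables to which
    \<open>Sub\<close> and \<open>Pair\<close> are applied.\<close>
  define Sub where "Sub i j = All 10 (Imp_fm (Mem 10 i) (Mem 10 j))" for i j
  define Pair where "Pair k i j = All 10 (Iff_fm (Mem 10 k)
     (Neg (Conj (Neg (Equal 10 i)) (Neg (Equal 10 j)))))" for k i j
  \<comment> \<open>Variables 4 and 5 are \<open>p\<close> and \<open>q\<close>, 6 and 7 the sets
    \<open>{p}\<close> and \<open>{p, q}\<close> of the Kuratowski pair in variable 2; variable 0 is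
    the bound.\<close>
  define \<phi> where "\<phi> = Ex_fm 4 (Ex_fm 5 (Conj
     (Ex_fm 6 (Ex_fm 7 (Conj (Pair 6 4 4) (Conj (Pair 7 4 5) (Pair 2 6 7)))))
     (Conj (Sub 4 0) (Conj (Sub 5 0) (Conj (Sub 5 4)
       (All 8 (Imp_fm (Conj (Mem 8 4) (Neg (Mem 8 5))) (All 9 (Imp_fm (Mem 9 5) (Mem 9 8))))))))))"
  have Sub: "sat M e (Sub i j) \<longleftrightarrow> elts (e i) \<subseteq> elts (e j)"
    if "e i \<in> M" "i \<noteq> 10" "j \<noteq> 10" for e i j
    using that trans_M unfolding Sub_def by auto
  have Pair: "sat M e (Pair k i j) \<longleftrightarrow> elts (e k) = {e i, e j}"
    if "e k \<in> M" "e i \<in> M" "e j \<in> M" "k \<noteq> 10" "i \<noteq> 10" "j \<noteq> 10" for e i j k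
    using elts_eq_iff[of "e k" "{e i, e j}"] that unfolding Pair_def by simp
  \<comment> \<open>The auxiliary sets of a pair in \<open>M\<close> lie in \<open>M\<close> by
    transitivity, so quantifiers over \<open>M\<close> suffice to express being the pair.\<close>
  have opair: "(\<exists>u\<in>M. elts u = {x} \<and> (\<exists>v\<in>M. elts v = {x, y} \<and> elts z = {u, v})) \<longleftrightarrow> z = opair x y"
    if "z \<in> M" for x y z
  proof
    assume "\<exists>u\<in>M. elts u = {x} \<and> (\<exists>v\<in>M. elts v = {x, y} \<and> elts z = {u, v})"
    then obtain u v where uv: "elts u = {x}" "elts v = {x, y}" "elts z = {u, v}" by blast
    have "u = hset_of {x}" "v = hset_of {x, y}"
      using uv(1,2) elts_hset_of_finite[of "{x}"] elts_hset_of_finite[of "{x, y}"] hset_ext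
      by (metis finite.emptyI finite_insert)+
    then show "z = opair x y" using uv(3) by (simp add: eq_opair_iff)
  next
    assume "z = opair x y"
    then have "elts z = {hset_of {x}, hset_of {x, y}}" by (simp only: eq_opair_iff)
    moreover then have "hset_of {x} \<in> M" "hset_of {x, y} \<in> M" using trans_M[OF that] by blast+
    ultimately show "\<exists>u\<in>M. elts u = {x} \<and> (\<exists>v\<in>M. elts v = {x, y} \<and> elts z = {u, v})"
      by (metis elts_hset_of_finite finite.emptyI finite_insert)
  qed
  have "\<exists>b\<in>M. elts b = {z \<in> M. \<exists>x\<in>elts w. P x z}"
  proof (rule definable_UN[OF w(1)])
    fix e :: "nat \<Rightarrow> 'k hset" assume "range e \<subseteq> M"
    then have e: "e i \<in> M" for i by auto
    have ee: "(\<forall>a\<in>M. a \<in> elts p \<and> a \<notin> elts q \<longrightarrow> (\<forall>b\<in>M. b \<in> elts q \<longrightarrow> b \<in> elts a))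
      \<longleftrightarrow> (\<forall>a\<in>elts p - elts q. \<forall>b\<in>elts q. b \<in> elts a)" if "p \<in> M" "q \<in> M" for p q
      using that trans_M by blast
    show "sat M e \<phi> \<longleftrightarrow> P (e 0) (e 2)"
      unfolding \<phi>_def P_def end_extends_def
      by (simp add: Sub Pair e ee opair cong: bex_cong conj_cong)
  next
    fix x assume "x \<in> elts w"
    then obtain n where n: "x = hnat n" using w by blast
    let ?S = "{z :: 'k hset. elts z \<subseteq> elts (hnat n)}"
    have "finite ((\<lambda>(p, q). opair p q) ` (?S \<times> ?S))"
      by (intro finite_imageI finite_cartesian_product finite_subsets_hnat)
    then show "finite {z \<in> M. P x z}"
      by (rule rev_finite_subset) (auto simp: P_def n)
  qed
  then obtain R where R: "R \<in> M" "elts R = {z \<in> M. \<exists>x\<in>elts w. P x z}" by blast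
  have "elts R = {opair p q |p q. p \<in> elts Q \<and> q \<in> elts Q \<and> end_extends p q}"
  proof (intro equalityI subsetI)
    fix z assume "z \<in> elts R"
    then show "z \<in> {opair p q |p q. p \<in> elts Q \<and> q \<in> elts Q \<and> end_extends p q}"
      unfolding R P_def Q w by blast
  next
    fix z assume "z \<in> {opair p q |p q. p \<in> elts Q \<and> q \<in> elts Q \<and> end_extends p q}"
    then obtain p q where z: "z = opair p q" "p \<in> elts Q" "q \<in> elts Q" "end_extends p q" by blast
    then obtain m n where "elts p \<subseteq> elts (hnat m)" "elts q \<subseteq> elts (hnat n)" using Q by blast
    then have "elts p \<subseteq> elts (hnat (max m n))" "elts q \<subseteq> elts (hnat (max m n))"
      by (force simp: elts_hnat)+
    moreover have "p \<in> M" "q \<in> M" using z Q trans_M by blast+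
    ultimately have "P (hnat (max m n)) z" "z \<in> M" using z unfolding P_def by (blast intro: opair_mem)+
    then show "z \<in> elts R" using R w by blast
  qed
  then show ?thesis using R by blast
qed

end

section \<open>Martin's Axiom for countable orders\<close>

lemma end_extends_subset: "end_extends p q \<Longrightarrow> elts q \<subseteq> elts p"
  unfolding end_extends_def by (rule conjunct1)

lemma end_extends_trans: "end_extends p q \<Longrightarrow> end_extends q r \<Longrightarrow> end_extends p r"
  unfolding end_extends_def
proof (intro conjI ballI; elim conjE)
  fix a b
  assume pq: "elts q \<subseteq> elts p" "\<forall>a\<in>elts p - elts q. \<forall>b\<in>elts q. b \<in> elts a"
    and qr: "elts r \<subseteq> elts q" "\<forall>a\<in>elts q - elts r. \<forall>b\<in>elts r. b \<in> elts a"
    and ab: "a \<in> elts p - elts r" "b \<in> elts r"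
  show "b \<in> elts a"
  proof (cases "a \<in> elts q")
    case True
    with ab(1) have "a \<in> elts q - elts r" by blast
    then show ?thesis by (rule bspec[OF bspec[OF qr(2)] ab(2)])
  next
    case False
    with ab(1) have "a \<in> elts p - elts q" by blast
    then show ?thesis by (rule bspec[OF bspec[OF pq(2)] subsetD[OF qr(1) ab(2)]])
  qed
qed (rule subset_trans)

lemma partial_order_end_extends:
  assumes "hrel R = {(p, q). p \<in> elts Q \<and> q \<in> elts Q \<and> end_extends p q}"
  shows "partial_order_on (elts Q) (hrel R)"
proof -
  have "trans (hrel R)"
  proof (rule transI)
    fix p q r assume "(p, q) \<in> hrel R" "(q, r) \<in> hrel R"
    then have "p \<in> elts Q" "r \<in> elts Q" "end_extends p q" "end_extends q r"
      unfolding assms by simp_all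
    then show "(p, r) \<in> hrel R" unfolding assms by (simp add: end_extends_trans[of p q r])
  qed
  moreover have "antisym (hrel R)"
  proof (rule antisymI)
    fix p q assume "(p, q) \<in> hrel R" "(q, p) \<in> hrel R"
    then have "end_extends p q" "end_extends q p" unfolding assms by simp_all
    then have "elts p = elts q" by (intro equalityI end_extends_subset)
    then show "p = q" by (simp only: hset_ext)
  qed
  moreover have "refl_on (elts Q) (hrel R)" unfolding assms refl_on_def end_extends_def by simp
  ultimately show ?thesis unfolding partial_order_on_def preorder_on_def assms by blast
qed

section \<open>From the model to finite sets of naturals\<close>

definition end_ext :: "nat set \<Rightarrow> nat set \<Rightarrow> bool" where
  "end_ext s t \<longleftrightarrow> t \<subseteq> s \<and> (\<forall>a\<in>s - t. \<forall>b\<in>t. b < a)"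

text \<open>The sets of the model are left behind here: \<open>dec\<close> is an isomorphism onto
  the finite sets of naturals, along which dense sets are pulled back and the filter is pushed
  forward.\<close>

lemma local_grMA_Cohen:
  assumes MA: "local_grMA TYPE('k)"
    and card: "|\<D>| <o continuum"
    and dense: "\<And>D s. D \<in> \<D> \<Longrightarrow> finite s \<Longrightarrow> \<exists>t\<in>D. finite t \<and> end_ext t s"
  shows "\<exists>F. (\<forall>s\<in>F. finite s) \<and> (\<forall>s\<in>F. \<forall>t\<in>F. \<exists>u\<in>F. end_ext u s \<and> end_ext u t) \<and>
    (\<forall>D\<in>\<D>. F \<inter> D \<noteq> {})"
proof -
  obtain M :: "'k hset set" where M: "transitive_ZFC_minus_model M"
    and filter: "\<And>Q R \<D>. opair Q R \<in> M \<Longrightarrow> poset Q R \<Longrightarrow> ccc (elts Q) (hrel R) \<Longrightarrow>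
        |\<D>| <o continuum \<Longrightarrow> \<forall>D\<in>\<D>. dense_in (elts Q) (hrel R) D \<Longrightarrow>
           (\<exists>F. filter_on (elts Q) (hrel R) F \<and> (\<forall>D\<in>\<D>. F \<inter> D \<noteq> {}))"
  proof -
    from MA obtain \<kappa> :: "'k rel" and M :: "'k hset set" where "transitive_ZFC_minus_model M"
      and "\<forall>Q R. opair Q R \<in> M \<and> poset Q R \<and> ccc (elts Q) (hrel R) \<longrightarrow>
        (\<forall>\<D>. |\<D>| <o continuum \<and> (\<forall>D\<in>\<D>. dense_in (elts Q) (hrel R) D) \<longrightarrow>
           (\<exists>F. filter_on (elts Q) (hrel R) F \<and> (\<forall>D\<in>\<D>. F \<inter> D \<noteq> {})))"
      unfolding local_grMA_def by (elim exE conjE) (rule that)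
    then show thesis by (intro that[of M]) simp_all
  qed
  interpret zfc_minus M by unfold_locales (rule M)
  obtain Q where Q: "Q \<in> M" "elts Q = {z. \<exists>n. elts z \<subseteq> elts (hnat n)}"
    using ex_finite_subsets_omega by blast
  obtain R where R: "R \<in> M"
    "elts R = {opair p q |p q. p \<in> elts Q \<and> q \<in> elts Q \<and> end_extends p q}"
    using ex_end_extension_order[OF Q] by blast
  have hrel: "hrel R = {(p, q). p \<in> elts Q \<and> q \<in> elts Q \<and> end_extends p q}"
    unfolding hrel_def R by auto
  have "hnat 0 \<in> elts Q" unfolding Q by blast
  then have poset: "poset Q R"
    unfolding poset_def using partial_order_end_extends[OF hrel] R by blast
  have "elts Q = (\<Union>n. {z. elts z \<subseteq> elts (hnat n)})" unfolding Q by blast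
  moreover have "countable (\<Union>n. {z :: 'k hset. elts z \<subseteq> elts (hnat n)})"
    by (intro countable_UN countableI_type countable_finite finite_subsets_hnat)
  ultimately have "countable (elts Q)" by simp
  then have ccc: "ccc (elts Q) (hrel R)"
    unfolding ccc_def strong_antichain_def using countable_subset by metis
  define dec :: "'k hset \<Rightarrow> nat set" where "dec q = {n. hnat n \<in> elts q}" for q
  define enc :: "nat set \<Rightarrow> 'k hset" where "enc s = hset_of (hnat ` s)" for s
  have elts_enc: "elts (enc s) = hnat ` s" if "finite s" for s
    unfolding enc_def using that by (simp add: elts_hset_of_finite)
  have enc_Q: "enc s \<in> elts Q" if s: "finite s" for s
  proof -
    obtain n where "s \<subseteq> {..<n}" using finite_nat_iff_bounded s by blast
    then have "elts (enc s) \<subseteq> elts (hnat n)" unfolding elts_enc[OF s] elts_hnat by blast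
    then show ?thesis unfolding Q by blast
  qed
  have dec_enc: "dec (enc s) = s" if "finite s" for s
    unfolding dec_def elts_enc[OF that] by (simp add: inj_image_mem_iff[OF inj_hnat])
  have elts_Q: "elts q = hnat ` dec q" "finite (dec q)" if q: "q \<in> elts Q" for q
  proof -
    obtain n where n: "elts q \<subseteq> elts (hnat n)" using q Q by blast
    then show "elts q = hnat ` dec q" unfolding dec_def by (auto simp: elts_hnat)
    have "dec q \<subseteq> {..<n}" using n unfolding dec_def by auto
    then show "finite (dec q)" by (rule finite_subset) simp
  qed
  have ext_iff: "end_extends p q \<longleftrightarrow> end_ext (dec p) (dec q)" if "p \<in> elts Q" "q \<in> elts Q" for p q
    unfolding end_extends_def end_ext_def elts_Q(1)[OF that(1)] elts_Q(1)[OF that(2)]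
    by (simp add: inj_image_subset_iff[OF inj_hnat] image_set_diff[OF inj_hnat, symmetric])
  let ?D = "\<lambda>D. {q \<in> elts Q. dec q \<in> D}"
  have card': "|?D ` \<D>| <o continuum" using card_of_image card by (rule ordLeq_ordLess_trans)
  have dense': "\<forall>D\<in>?D ` \<D>. dense_in (elts Q) (hrel R) D"
  proof
    fix D' assume "D' \<in> ?D ` \<D>"
    then obtain D where D: "D \<in> \<D>" "D' = ?D D" by blast
    have "\<exists>d\<in>D'. (d, p) \<in> hrel R" if p: "p \<in> elts Q" for p
    proof -
      obtain t where t: "t \<in> D" "finite t" "end_ext t (dec p)"
        using dense[OF D(1) elts_Q(2)[OF p]] by blast
      then have "enc t \<in> D'" using D enc_Q dec_enc by simp
      moreover have "(enc t, p) \<in> hrel R"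
        unfolding hrel using p t enc_Q ext_iff dec_enc by simp
      ultimately show ?thesis by blast
    qed
    then show "dense_in (elts Q) (hrel R) D'" unfolding dense_in_def using D by blast
  qed
  obtain F where F: "filter_on (elts Q) (hrel R) F" "\<forall>D\<in>?D ` \<D>. F \<inter> D \<noteq> {}"
    using filter[OF opair_mem[OF Q(1) R(1)] poset ccc card' dense'] by (elim exE conjE) (rule that)
  have FQ: "F \<subseteq> elts Q" and dir: "\<forall>p\<in>F. \<forall>q\<in>F. \<exists>s\<in>F. (s, p) \<in> hrel R \<and> (s, q) \<in> hrel R"
    using F(1) unfolding filter_on_def by blast+
  have "\<forall>s\<in>dec ` F. finite s" using FQ elts_Q(2) by blast
  moreover have "\<forall>s\<in>dec ` F. \<forall>t\<in>dec ` F. \<exists>u\<in>dec ` F. end_ext u s \<and> end_ext u t"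
  proof (intro ballI)
    fix s t assume "s \<in> dec ` F" "t \<in> dec ` F"
    then obtain p q where pq: "p \<in> F" "q \<in> F" "s = dec p" "t = dec q" by blast
    then obtain r where "r \<in> F" "(r, p) \<in> hrel R" "(r, q) \<in> hrel R" using dir by blast
    then show "\<exists>u\<in>dec ` F. end_ext u s \<and> end_ext u t"
      unfolding hrel pq using ext_iff by blast
  qed
  moreover have "\<forall>D\<in>\<D>. dec ` F \<inter> D \<noteq> {}"
  proof
    fix D assume "D \<in> \<D>"
    then have "F \<inter> ?D D \<noteq> {}" by (rule bspec[OF F(2) imageI])
    then show "dec ` F \<inter> D \<noteq> {}" by blast
  qed
  ultimately show ?thesis by (intro exI[of _ "dec ` F"] conjI)
qed

text \<open>The added elements exceed all old ones, so the concatenation is sorted and distinct,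
  which determines it. This turns end-extension into list extension, along which a fold
  continues.\<close>

lemma sorted_list_of_set_end_ext:
  assumes "finite s" "end_ext s t"
  shows "sorted_list_of_set s = sorted_list_of_set t @ sorted_list_of_set (s - t)"
proof -
  have t: "finite t" "t \<subseteq> s" "\<forall>a\<in>s - t. \<forall>b\<in>t. b < a"
    using assms finite_subset unfolding end_ext_def by auto
  show ?thesis
    by (rule sorted_distinct_set_unique) (use t assms(1) in \<open>auto simp: sorted_append less_imp_le\<close>)
qed

text \<open>A finite set of numbers codes a descending walk through the order: every element, in
  increasing order, names a point to which the walk moves if that point lies below the current one.
  Each point has infinitely many names, so dense sets pull back to dense sets.\<close>

lemma local_grMA_countable:
  fixes le :: "'a :: countable \<Rightarrow> 'a \<Rightarrow> bool"
  assumes MA: "local_grMA TYPE('k)"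
    and refl: "\<And>p. le p p" and trans: "\<And>p q r. le p q \<Longrightarrow> le q r \<Longrightarrow> le p r"
    and card: "|\<D>| <o continuum"
    and dense: "\<And>D p. D \<in> \<D> \<Longrightarrow> \<exists>d\<in>D. le d p"
  shows "\<exists>G. (\<forall>p\<in>G. \<forall>q\<in>G. \<exists>r\<in>G. le r p \<and> le r q) \<and> (\<forall>D\<in>\<D>. G \<inter> D \<noteq> {})"
proof -
  define point :: "nat \<Rightarrow> 'a" where "point a = from_nat (fst (prod_decode a))" for a
  define step where "step p a = (if le (point a) p then point a else p)" for p a
  \<comment> \<open>\<open>undefined\<close> is an arbitrary starting point; density is assumed
    below every point.\<close>
  define walk where "walk s = foldl step undefined (sorted_list_of_set s)" for s
  have foldl_le: "le (foldl step p as) p" for p as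
    by (induction as arbitrary: p) (auto simp: step_def intro: refl trans)
  have walk_le: "le (walk s) (walk t)" if "finite s" "end_ext s t" for s t
    unfolding walk_def sorted_list_of_set_end_ext[OF that] by (simp add: foldl_le)
  let ?D = "\<lambda>D. {s. walk s \<in> D}"
  have card': "|?D ` \<D>| <o continuum" using card_of_image card by (rule ordLeq_ordLess_trans)
  have dense': "\<exists>t\<in>D'. finite t \<and> end_ext t s" if D': "D' \<in> ?D ` \<D>" and s: "finite s" for D' s
  proof -
    obtain D where D: "D \<in> \<D>" "D' = ?D D" using D' by blast
    obtain d where d: "d \<in> D" "le d (walk s)" using dense[OF D(1)] by blast
    obtain n where n: "s \<subseteq> {..<n}" using finite_nat_iff_bounded s by blast
    \<comment> \<open>The padding \<open>n\<close> pushes this name of \<open>d\<close> above all of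
      \<open>s\<close>, so that it is read last and the walk ends in \<open>d\<close>.\<close>
    define a where "a = prod_encode (to_nat d, n)"
    have a: "n \<le> a" "point a = d" unfolding a_def point_def by (auto simp: le_prod_encode_2)
    then have ext: "end_ext (insert a s) s" "insert a s - s = {a}"
      using n unfolding end_ext_def by fastforce+
    have "walk (insert a s) = step (walk s) a"
      unfolding walk_def using sorted_list_of_set_end_ext[OF _ ext(1)] s ext(2) by simp
    then have "walk (insert a s) = d" using d a by (simp add: step_def)
    then show ?thesis using d D s ext by blast
  qed
  obtain F where F: "\<forall>s\<in>F. finite s"
    "\<forall>s\<in>F. \<forall>t\<in>F. \<exists>u\<in>F. end_ext u s \<and> end_ext u t" "\<forall>D\<in>?D ` \<D>. F \<inter> D \<noteq> {}"
    by (rule exE[OF local_grMA_Cohen[OF MA card']], erule (1) dense', elim conjE, rule that)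
  have "\<forall>p\<in>walk ` F. \<forall>q\<in>walk ` F. \<exists>r\<in>walk ` F. le r p \<and> le r q"
  proof (intro ballI)
    fix p q assume "p \<in> walk ` F" "q \<in> walk ` F"
    then obtain s t where st: "s \<in> F" "t \<in> F" "p = walk s" "q = walk t" by blast
    then obtain u where "u \<in> F" "end_ext u s" "end_ext u t" using F(2) by blast
    then show "\<exists>r\<in>walk ` F. le r p \<and> le r q" using F(1) walk_le unfolding st by blast
  qed
  moreover have "\<forall>D\<in>\<D>. walk ` F \<inter> D \<noteq> {}"
  proof
    fix D assume "D \<in> \<D>"
    then have "F \<inter> ?D D \<noteq> {}" by (rule bspec[OF F(3) imageI])
    then show "walk ` F \<inter> D \<noteq> {}" by blast
  qed
  ultimately show ?thesis by (intro exI[of _ "walk ` F"] conjI)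
qed

text \<open>An infinite set absorbs the factor, and for a countable one the product is countable,
  hence below the uncountable continuum.\<close>

lemma card_of_Times_nat_ordLess_continuum:
  assumes "|A| <o continuum"
  shows "|A \<times> (UNIV :: nat set)| <o continuum"
proof (cases "|UNIV :: nat set| \<le>o |A|")
  case True
  then have "infinite A" by (simp add: infinite_iff_card_of_nat)
  then have "|A \<times> (UNIV :: nat set)| =o |A|"
    using True by (intro card_of_Times_infinite_simps(1)) auto
  then show ?thesis using assms ordIso_ordLess_trans by blast
next
  case False
  have "|A| \<le>o |UNIV :: nat set|"
    using False ordLeq_total[OF card_of_Well_order card_of_Well_order] by blast
  then have "countable A" unfolding countable_def card_of_ordLeq[symmetric] by simp
  then have "countable (A \<times> (UNIV :: nat set))" by simp
  then have "|A \<times> (UNIV :: nat set)| \<le>o |UNIV :: nat set|"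
    unfolding countable_def card_of_ordLeq[symmetric] by simp
  also have "|UNIV :: nat set| <o continuum"
    using uncountable_UNIV_real
    unfolding countable_def not_ordLeq_iff_ordLess[OF card_of_Well_order card_of_Well_order, symmetric]
      card_of_ordLeq[symmetric] by simp
  finally (ordLeq_ordLess_trans) show ?thesis .
qed

text \<open>Each parameter may impose countably many requirements, such as one for every nowhere
  dense piece of a meagre set or one for every lower bound on a position.\<close>

lemma local_grMA_countable_family:
  fixes le :: "'a :: countable \<Rightarrow> 'a \<Rightarrow> bool" and D :: "'b \<Rightarrow> nat \<Rightarrow> 'a set"
  assumes MA: "local_grMA TYPE('k)"
    and refl: "\<And>p. le p p" and trans: "\<And>p q r. le p q \<Longrightarrow> le q r \<Longrightarrow> le p r"
    and card: "|A| <o continuum"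
    and dense: "\<And>a n p. a \<in> A \<Longrightarrow> \<exists>d\<in>D a n. le d p"
  shows "\<exists>G. (\<forall>p\<in>G. \<forall>q\<in>G. \<exists>r\<in>G. le r p \<and> le r q) \<and> (\<forall>a\<in>A. \<forall>n. G \<inter> D a n \<noteq> {})"
proof -
  let ?\<D> = "(\<lambda>(a, n). D a n) ` (A \<times> UNIV)"
  have "|?\<D>| <o continuum"
    using card_of_image card_of_Times_nat_ordLess_continuum[OF card] by (rule ordLeq_ordLess_trans)
  moreover have "\<exists>d\<in>E. le d p" if "E \<in> ?\<D>" for E p using that dense by auto
  ultimately have "\<exists>G. (\<forall>p\<in>G. \<forall>q\<in>G. \<exists>r\<in>G. le r p \<and> le r q) \<and> (\<forall>E\<in>?\<D>. G \<inter> E \<noteq> {})"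
    by (intro local_grMA_countable[OF MA refl trans])
  then show ?thesis by auto
qed

section \<open>Generic reals and sequences\<close>

lemma directed_finite_lower_bound:
  assumes "\<forall>p\<in>G. \<forall>q\<in>G. \<exists>r\<in>G. le r p \<and> le r q" "G \<noteq> {}"
    and trans: "\<And>p q r. le p q \<Longrightarrow> le q r \<Longrightarrow> le p r"
    and "finite A" "A \<subseteq> G"
  shows "\<exists>r\<in>G. \<forall>p\<in>A. le r p"
  using assms(4,5)
proof (induction A)
  case empty
  then show ?case using assms(2) by blast
next
  case (insert a A)
  then obtain r where r: "r \<in> G" "\<forall>p\<in>A. le r p" by blast
  then obtain s where "s \<in> G" "le s r" "le s a" using assms(1) insert.prems by blast
  then show ?case using r(2) trans by blast
qed

lemma rational_cball_in_open:
  fixes W :: "real set"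
  assumes "open W" "W \<noteq> {}"
  shows "\<exists>q n. cball (of_rat q) (1 / real (Suc n)) \<subseteq> W"
proof -
  obtain x e where e: "e > 0" "ball x e \<subseteq> W" using assms open_contains_ball by blast
  obtain q where q: "x < of_rat q" "of_rat q < x + e / 2"
    using of_rat_dense[of x "x + e / 2"] e(1) by auto
  obtain n where n: "1 / real (Suc n) < e / 2"
    using reals_Archimedean[of "e / 2"] e(1) by (auto simp: inverse_eq_divide)
  have "cball (of_rat q) (1 / real (Suc n)) \<subseteq> ball x e"
    using q n by (auto simp: dist_real_def)
  then show ?thesis using e(2) by blast
qed

text \<open>Conditions are closed rational intervals under inclusion. Closedness yields the generic
  real by compactness: finitely many members of a directed family contain a common interval.\<close>

lemma local_grMA_avoid_meagre:
  assumes MA: "local_grMA TYPE('k)" and F: "F \<subseteq> meagre_sets" "|F| <o continuum"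
  shows "\<Union>F \<noteq> UNIV"
proof -
  have "\<forall>B\<in>F. \<exists>N :: nat \<Rightarrow> real set. B = (\<Union>n. N n) \<and> (\<forall>n. interior (closure (N n)) = {})"
    using F(1) unfolding meagre_sets_def by blast
  then obtain N :: "real set \<Rightarrow> nat \<Rightarrow> real set" where
    N: "\<And>B. B \<in> F \<Longrightarrow> B = (\<Union>n. N B n)" "\<And>B n. B \<in> F \<Longrightarrow> interior (closure (N B n)) = {}"
    by metis
  define K :: "rat \<times> nat \<Rightarrow> real set" where "K p = cball (of_rat (fst p)) (1 / real (Suc (snd p)))" for p
  let ?le = "\<lambda>p q. K p \<subseteq> K q"
  have dense: "\<exists>d\<in>{d. K d \<inter> N B n = {}}. ?le d p" if "B \<in> F" for B n p
  proof -
    let ?O = "ball (of_rat (fst p)) (1 / real (Suc (snd p)))"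
    have "?O \<noteq> {}" by simp
    \<comment> \<open>The closure of a nowhere dense set cannot contain the open ball, so an open
      piece of the ball avoids it and holds a smaller interval.\<close>
    then have "\<not> ?O \<subseteq> closure (N B n)"
      using N(2)[OF that] interior_maximal[of ?O "closure (N B n)"] by auto
    then have "open (?O - closure (N B n))" "?O - closure (N B n) \<noteq> {}" by auto
    from rational_cball_in_open[OF this] obtain q m where
      "K (q, m) \<subseteq> ?O - closure (N B n)" unfolding K_def by auto
    moreover have "?O \<subseteq> K p" unfolding K_def by auto
    ultimately show ?thesis using closure_subset[of "N B n"] by blast
  qed
  obtain G where G: "\<forall>p\<in>G. \<forall>q\<in>G. \<exists>r\<in>G. ?le r p \<and> ?le r q"
    "\<forall>B\<in>F. \<forall>n. G \<inter> {d. K d \<inter> N B n = {}} \<noteq> {}"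
    by (rule exE[OF local_grMA_countable_family[OF MA _ _ F(2), of ?le "\<lambda>B n. {d. K d \<inter> N B n = {}}"]])
      (use dense in auto)
  show ?thesis
  \<comment> \<open>Without meagre sets there are no requirements and \<open>G\<close> may be empty;
    otherwise a member \<open>p0\<close> supplies the compact set.\<close>
  proof (cases "F = {}")
    case False
    then obtain p0 where p0: "p0 \<in> G" using G(2) by blast
    have "K p0 \<inter> (\<Inter>p\<in>G. K p) \<noteq> {}"
    proof (rule compact_imp_fip_image)
      fix A assume "finite A" "A \<subseteq> G"
      then obtain r where r: "r \<in> G" "\<forall>p\<in>insert p0 A. K r \<subseteq> K p"
        using directed_finite_lower_bound[OF G(1), of "insert p0 A"] p0 by blast
      have "of_rat (fst r) \<in> K r" unfolding K_def by simp
      then show "K p0 \<inter> (\<Inter>p\<in>A. K p) \<noteq> {}" using r(2) by blast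
    qed (simp_all add: K_def)
    then obtain x where x: "\<And>p. p \<in> G \<Longrightarrow> x \<in> K p" by blast
    have "x \<notin> B" if "B \<in> F" for B
    proof -
      have "x \<notin> N B n" for n using G(2) that x by blast
      then show ?thesis using N(1)[OF that] by blast
    qed
    then show ?thesis by blast
  qed simp
qed

section \<open>Sequences generic for finite lists under extension\<close>

definition extends :: "'a list \<Rightarrow> 'a list \<Rightarrow> bool" where
  "extends t s \<longleftrightarrow> (\<exists>u. t = s @ u)"

lemma extends_refl: "extends s s"
  by (simp add: extends_def)

lemma extends_trans: "extends t s \<Longrightarrow> extends s r \<Longrightarrow> extends t r"
  by (auto simp: extends_def)

text \<open>Members of a directed family of lists agree where both are defined, so each is an
  initial segment of one sequence. A requirement is a property that every finite list can be
  extended to satisfy.\<close>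

lemma local_grMA_generic_sequence:
  fixes P :: "'b \<Rightarrow> nat \<Rightarrow> 'a :: countable list \<Rightarrow> bool"
  assumes MA: "local_grMA TYPE('k)" and card: "|A| <o continuum"
    and dense: "\<And>a n s. a \<in> A \<Longrightarrow> \<exists>u. P a n (s @ u)"
  shows "\<exists>f. \<forall>a\<in>A. \<forall>n. \<exists>m. P a n (map f [0..<m])"
proof -
  have "\<exists>G. (\<forall>p\<in>G. \<forall>q\<in>G. \<exists>r\<in>G. extends r p \<and> extends r q) \<and>
      (\<forall>a\<in>A. \<forall>n. G \<inter> {s. P a n s} \<noteq> {})"
  proof (rule local_grMA_countable_family[OF MA extends_refl _ card])
    fix a n s assume "a \<in> A"
    then show "\<exists>d\<in>{s. P a n s}. extends d s" using dense[of a n s] unfolding extends_def by blast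
  qed (rule extends_trans)
  then obtain G where dir: "\<forall>p\<in>G. \<forall>q\<in>G. \<exists>r\<in>G. extends r p \<and> extends r q"
    and G: "\<forall>a\<in>A. \<forall>n. G \<inter> {s. P a n s} \<noteq> {}" by (elim exE conjE) (rule that)
  have agree: "p ! i = q ! i" if pq: "p \<in> G" "q \<in> G" "i < length p" "i < length q" for p q i
  proof -
    obtain r where "extends r p" "extends r q" using dir pq(1,2) by blast
    then show ?thesis using pq(3,4) unfolding extends_def by (metis nth_append)
  qed
  \<comment> \<open>Where no member of \<open>G\<close> is long enough the value is arbitrary; the
    requirements are met by lists in \<open>G\<close>.\<close>
  define f where "f i = (SOME s. s \<in> G \<and> i < length s) ! i" for i
  have f: "map f [0..<length s] = s" if "s \<in> G" for s
  proof (rule nth_equalityI)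
    fix i assume "i < length (map f [0..<length s])"
    then have i: "i < length s" by simp
    define w where "w = (SOME s. s \<in> G \<and> i < length s)"
    have "w \<in> G \<and> i < length w" unfolding w_def by (rule someI[of _ s]) (use that i in simp)
    then have "w ! i = s ! i" using agree[of w s i] that i by blast
    then show "map f [0..<length s] ! i = s ! i" using i by (simp add: f_def w_def)
  qed simp
  show ?thesis
  proof (intro exI[of _ f] ballI allI)
    fix a n assume "a \<in> A"
    then obtain s where "s \<in> G" "P a n s" using G by blast
    then show "\<exists>m. P a n (map f [0..<m])" using f[of s] by (intro exI[of _ "length s"]) simp
  qed
qed

lemma local_grMA_undominated:
  fixes F :: "(nat \<Rightarrow> nat) set"
  assumes MA: "local_grMA TYPE('k)" and "|F| <o continuum"
  shows "\<exists>f. \<forall>g\<in>F. \<not> (\<forall>\<^sub>F n in sequentially. f n \<le> g n)"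
proof -
  \<comment> \<open>The property is written as a redex so that it matches the shape of
    \<open>P\<close>.\<close>
  have "\<exists>f :: nat \<Rightarrow> nat. \<forall>g\<in>F. \<forall>n. \<exists>m. (\<lambda>g n s. \<exists>i<length s. n \<le> i \<and> g i < s ! i) g n (map f [0..<m])"
  proof (rule local_grMA_generic_sequence[OF assms])
    fix g :: "nat \<Rightarrow> nat" and n and s :: "nat list"
    \<comment> \<open>Appending \<open>n + 1\<close> entries makes the last position
      \<open>length s + n\<close>, which is at least \<open>n\<close> for every
      \<open>s\<close>.\<close>
    let ?t = "s @ map (\<lambda>i. Suc (g i)) [length s..<length s + Suc n]"
    have "length s + n < length ?t" "n \<le> length s + n" "g (length s + n) < ?t ! (length s + n)"
      by (simp_all add: nth_append del: upt_Suc)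
    then show "\<exists>u. \<exists>i<length (s @ u). n \<le> i \<and> g i < (s @ u) ! i" by blast
  qed
  then obtain f :: "nat \<Rightarrow> nat" where "\<forall>g\<in>F. \<forall>n. \<exists>i\<ge>n. g i < f i" by fastforce
  then show ?thesis unfolding eventually_sequentially by (metis not_le)
qed

lemma local_grMA_split:
  assumes MA: "local_grMA TYPE('k)" and "|R| <o continuum" and inf: "\<forall>x\<in>R. infinite x"
  shows "\<exists>y. \<forall>x\<in>R. splits y x"
proof -
  have "\<exists>f. \<forall>x\<in>R. \<forall>n. \<exists>m. (\<lambda>x n s. (\<exists>i<length s. n \<le> i \<and> i \<in> x \<and> s ! i) \<and>
      (\<exists>i<length s. n \<le> i \<and> i \<in> x \<and> \<not> s ! i)) x n (map f [0..<m])"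
  proof (rule local_grMA_generic_sequence[OF assms(1,2)])
    fix x :: "nat set" and n and s :: "bool list"
    assume "x \<in> R"
    then have "infinite x" using inf by blast
    then obtain i where i: "i \<in> x" "max n (length s) < i"
      unfolding infinite_nat_iff_unbounded by blast
    obtain j where j: "j \<in> x" "i < j"
      using \<open>infinite x\<close> unfolding infinite_nat_iff_unbounded by blast
    \<comment> \<open>Among the new positions only \<open>i\<close> is put into the set; the later
      \<open>j\<close> in \<open>x\<close> stays out. Both lie beyond \<open>n\<close>, and having
      this for all \<open>n\<close> makes both parts of \<open>x\<close> infinite.\<close>
    let ?t = "s @ map (\<lambda>k. k = i) [length s..<Suc j]"
    have nth: "?t ! k \<longleftrightarrow> k = i" if "length s \<le> k" "k \<le> j" for k
    proof -
      have "k - length s < Suc j - length s" using that by linarith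
      then show ?thesis using that by (simp add: nth_append nth_map_upt del: upt_Suc)
    qed
    have "i < length ?t" "j < length ?t" "?t ! i" "\<not> ?t ! j"
      using nth[of i] nth[of j] i j by (auto simp del: upt_Suc)
    moreover have "n \<le> i" "n \<le> j" using i j by simp_all
    ultimately show "\<exists>u. (\<exists>i<length (s @ u). n \<le> i \<and> i \<in> x \<and> (s @ u) ! i) \<and>
      (\<exists>i<length (s @ u). n \<le> i \<and> i \<in> x \<and> \<not> (s @ u) ! i)" using i(1) j(1) by blast
  qed
  then obtain f where f: "\<forall>x\<in>R. \<forall>n. (\<exists>i\<ge>n. i \<in> x \<and> f i) \<and> (\<exists>i\<ge>n. i \<in> x \<and> \<not> f i)"
    by fastforce
  have "splits {i. f i} x" if "x \<in> R" for x
    unfolding splits_def infinite_nat_iff_unbounded_le using f that by auto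
  then show ?thesis by blast
qed

text \<open>Borel-Cantelli: ball \<open>i\<close> has length \<open>2 * (1 / 2) ^ i\<close>, and
  these lengths are summable.\<close>

lemma null_limsup_ball:
  fixes c :: "nat \<Rightarrow> real"
  shows "{x. \<forall>n. \<exists>i\<ge>n. dist x (c i) < (1 / 2) ^ i} \<in> null_sets lebesgue"
proof -
  have "limsup (\<lambda>i. ball (c i) ((1 / 2) ^ i)) \<in> null_sets lebesgue"
  proof (rule borel_cantelli_limsup1)
    have "(\<lambda>i. measure lebesgue (ball (c i) ((1 / 2) ^ i))) = (\<lambda>i. 2 * (1 / 2 :: real) ^ i)"
      by (simp add: content_ball)
    then show "summable (\<lambda>i. measure lebesgue (ball (c i) ((1 / 2) ^ i)))"
      by (simp add: summable_mult summable_geometric)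
    show "emeasure lebesgue (ball (c i) ((1 / 2) ^ i)) < \<infinity>" for i
      using emeasure_bounded_finite[of "ball (c i) ((1 / 2) ^ i)"] by simp
  qed simp
  moreover have "limsup (\<lambda>i. ball (c i) ((1 / 2) ^ i)) = {x. \<forall>n. \<exists>i\<ge>n. dist x (c i) < (1 / 2) ^ i}"
    by (auto simp: mem_limsup_iff frequently_sequentially dist_commute)
  ultimately show ?thesis by simp
qed

text \<open>Rothberger's argument: the balls around a Cohen sequence of centres, with summable radii,
  catch every given real infinitely often.\<close>

lemma local_grMA_null:
  assumes MA: "local_grMA TYPE('k)" and "|A| <o continuum"
  shows "A \<in> null_ideal"
proof -
  have "\<exists>f :: nat \<Rightarrow> rat. \<forall>x\<in>A. \<forall>n. \<exists>m.
    (\<lambda>x n s. \<exists>i<length s. n \<le> i \<and> dist x (of_rat (s ! i)) < (1 / 2) ^ i) x n (map f [0..<m])"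
  proof (rule local_grMA_generic_sequence[OF assms])
    fix x :: real and n and s :: "rat list"
    obtain q where q: "x < of_rat q" "of_rat q < x + (1 / 2) ^ (length s + n)"
      using of_rat_dense[of x "x + (1 / 2) ^ (length s + n)"] by auto
    \<comment> \<open>\<open>q\<close> is accurate enough for the radius at the last position
      \<open>length s + n\<close>; the copies before it only fill the gap.\<close>
    let ?t = "s @ replicate (Suc n) q"
    have "length s + n < length ?t" "n \<le> length s + n"
      "dist x (of_rat (?t ! (length s + n))) < (1 / 2) ^ (length s + n)"
      using q by (simp_all add: nth_append dist_real_def del: replicate_Suc)
    then show "\<exists>u. \<exists>i<length (s @ u). n \<le> i \<and> dist x (of_rat ((s @ u) ! i)) < (1 / 2) ^ i" by blast
  qed
  then obtain f :: "nat \<Rightarrow> rat" where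
    "\<forall>x\<in>A. \<forall>n. \<exists>i\<ge>n. dist x (of_rat (f i)) < (1 / 2) ^ i" by fastforce
  then have "A \<subseteq> {x. \<forall>n. \<exists>i\<ge>n. dist x (of_rat (f i)) < (1 / 2) ^ i}" by blast
  \<comment> \<open>Passing to negligible sets gives all subsets at once, so no measurability of
    \<open>A\<close> has to be shown.\<close>
  moreover have "negligible {x. \<forall>n. \<exists>i\<ge>n. dist x (real_of_rat (f i)) < (1 / 2) ^ i}"
    unfolding negligible_iff_null_sets by (rule null_limsup_ball)
  ultimately show ?thesis
    unfolding negligible_iff_null_sets[symmetric] by (rule negligible_subset[rotated])
qed

section \<open>Upper bounds\<close>

text \<open>A relation codes a sequence of sets of naturals through its sections; such a sequence in
  turn codes a sequence of open sets.\<close>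

lemma card_of_nat_rel: "|UNIV :: (nat \<times> nat) set set| \<le>o continuum"
proof -
  have "inj (image prod_encode)" by (rule injI) (simp add: inj_image_eq_iff[OF inj_prod_encode])
  then have "|UNIV :: (nat \<times> nat) set set| \<le>o |UNIV :: nat set set|"
    by (rule card_of_ordLeqI) simp
  also have "|UNIV :: nat set set| =o continuum"
    using nat_sets_eqpoll_reals by (simp only: eqpoll_iff_card_of_ordIso)
  finally (ordLeq_ordIso_trans) show ?thesis .
qed

text \<open>By second countability an open set is a union of members of a countable basis, so a set
  of indices codes it.\<close>

lemma ex_open_code:
  "\<exists>U :: nat set \<Rightarrow> real set. (\<forall>S. open (U S)) \<and> (\<forall>T. open T \<longrightarrow> (\<exists>S. U S = T))"
proof -
  obtain B :: "real set set" where B: "countable B" "topological_basis B"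
    using ex_countable_basis by blast
  \<comment> \<open>The basis is non-empty, as it has to cover some point; this lets
    \<open>from_nat_into\<close> enumerate exactly its members.\<close>
  obtain T where T: "T \<in> B" using topological_basisE[OF B(2) open_UNIV UNIV_I] by metis
  then have rng: "range (from_nat_into B) = B" using B(1) by (intro range_from_nat_into) auto
  show ?thesis
  proof (intro exI[of _ "\<lambda>S. \<Union> (from_nat_into B ` S)"] conjI allI impI)
    fix S
    show "open (\<Union> (from_nat_into B ` S))"
    proof (rule open_UN, rule ballI)
      fix n assume "n \<in> S"
      have "from_nat_into B n \<in> B" using rng by (metis rangeI)
      then show "open (from_nat_into B n)" by (rule topological_basis_open[OF B(2)])
    qed
  next
    fix T :: "real set" assume "open T"
    then obtain B' where B': "B' \<subseteq> B" "\<Union>B' = T" using B(2) unfolding topological_basis_def by blast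
    then have "from_nat_into B ` (from_nat_into B -` B') = B'" using rng by auto
    then show "\<exists>S. \<Union> (from_nat_into B ` S) = T" using B'(2) by metis
  qed
qed

text \<open>Coded supersets are cofinal, and there are at most continuum many codes. Codes of sets
  outside the ideal are discarded by intersecting with \<open>I\<close>.\<close>

lemma cof_le_continuum:
  fixes G :: "(nat \<times> nat) set \<Rightarrow> real set"
  assumes "\<And>A. A \<in> I \<Longrightarrow> \<exists>S. A \<subseteq> G S \<and> G S \<in> I"
  shows "cof I \<le>o continuum"
proof -
  have "cof I \<le>o |range G \<inter> I|"
    unfolding cof_def by (rule least_card(2)) (use assms in blast)+
  also have "|range G \<inter> I| \<le>o |range G|" by (rule card_of_mono1) blast
  also have "|range G| \<le>o |UNIV :: (nat \<times> nat) set set|" by (rule card_of_image)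
  also note card_of_nat_rel
  finally (ordLeq_transitive) show ?thesis .
qed

text \<open>Closing the nowhere dense pieces puts a meagre set inside a meagre F-sigma set, which is
  coded through the complements of the closures.\<close>

lemma cof_meagre_le_continuum: "cof meagre_sets \<le>o continuum"
proof -
  obtain U :: "nat set \<Rightarrow> real set" where U: "\<And>T. open T \<Longrightarrow> \<exists>S. U S = T"
    using ex_open_code by blast
  show ?thesis
  proof (rule cof_le_continuum[of _ "\<lambda>S. \<Union>n. - U (S `` {n})"])
    fix A assume "A \<in> meagre_sets"
    then obtain N :: "nat \<Rightarrow> real set" where N: "A = (\<Union>n. N n)" "\<And>n. interior (closure (N n)) = {}"
      unfolding meagre_sets_def by blast
    have "\<forall>n. \<exists>S. U S = - closure (N n)" using U by blast
    then obtain S where S: "\<And>n. U (S n) = - closure (N n)" by metis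
    have "Sigma UNIV S `` {n} = S n" for n by blast
    then have eq: "(\<Union>n. - U (Sigma UNIV S `` {n})) = (\<Union>n. closure (N n))" using S by simp
    have "A \<subseteq> (\<Union>n. closure (N n))" using N(1) closure_subset by blast
    moreover have "(\<Union>n. closure (N n)) \<in> meagre_sets"
      unfolding meagre_sets_def using N(2) by (auto intro!: exI[of _ "\<lambda>n. closure (N n)"])
    ultimately have "A \<subseteq> (\<Union>n. - U (Sigma UNIV S `` {n})) \<and> (\<Union>n. - U (Sigma UNIV S `` {n})) \<in> meagre_sets"
      unfolding eq by (rule conjI)
    then show "\<exists>S :: (nat \<times> nat) set. A \<subseteq> (\<Union>n. - U (S `` {n})) \<and> (\<Union>n. - U (S `` {n})) \<in> meagre_sets"
      by (rule exI)
  qed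
qed

text \<open>Outer regularity: a null set lies in open sets of arbitrarily small measure, hence in a
  null G-delta set.\<close>

lemma null_open_cover:
  assumes "A \<in> null_ideal"
  shows "\<exists>T :: nat \<Rightarrow> real set. (\<forall>n. open (T n) \<and> A \<subseteq> T n) \<and> (\<Inter>n. T n) \<in> null_ideal"
proof -
  have "\<exists>T. open T \<and> A \<subseteq> T \<and> emeasure lebesgue T < ennreal (1 / real (Suc n))" for n
  proof -
    obtain T where T: "open T" "A \<subseteq> T" "emeasure lebesgue (T - A) < ennreal (1 / real (Suc n))"
      by (rule sets_lebesgue_outer_open[OF null_setsD2[OF assms], of "1 / real (Suc n)"])
        (simp, rule that)
    \<comment> \<open>Regularity bounds only the difference; removing the null set \<open>A\<close>
      does not change the measure of \<open>T\<close>.\<close>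
    moreover have "emeasure lebesgue (T - A) = emeasure lebesgue T"
      by (rule emeasure_Diff_null_set) (use T(1) assms in auto)
    ultimately show ?thesis by metis
  qed
  then obtain T where T: "\<And>n. open (T n)" "\<And>n. A \<subseteq> T n"
    "\<And>n. emeasure lebesgue (T n) < ennreal (1 / real (Suc n))" by metis
  have sets: "(\<Inter>n. T n) \<in> sets lebesgue" using T(1) by (intro sets.countable_INT'') auto
  have "emeasure lebesgue (\<Inter>n. T n) \<le> 0"
  proof (rule LIMSEQ_le_const)
    have "(\<lambda>n. ennreal (1 / real (Suc n))) \<longlonglongrightarrow> ennreal 0"
      by (intro tendsto_ennrealI) (rule LIMSEQ_Suc[OF lim_1_over_n])
    then show "(\<lambda>n. ennreal (1 / real (Suc n))) \<longlonglongrightarrow> 0" by simp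
    have "emeasure lebesgue (\<Inter>n. T n) \<le> ennreal (1 / real (Suc n))" for n
      by (rule order.trans[OF emeasure_mono less_imp_le[OF T(3)]]) (use T(1) in auto)
    then show "\<exists>N. \<forall>n\<ge>N. emeasure lebesgue (\<Inter>n. T n) \<le> ennreal (1 / real (Suc n))" by blast
  qed
  then show ?thesis using T(1,2) sets by (intro exI[of _ T]) (auto simp: null_sets_def)
qed

lemma cof_null_le_continuum: "cof null_ideal \<le>o continuum"
proof -
  obtain U :: "nat set \<Rightarrow> real set" where U: "\<And>T. open T \<Longrightarrow> \<exists>S. U S = T"
    using ex_open_code by blast
  show ?thesis
  proof (rule cof_le_continuum[of _ "\<lambda>S. \<Inter>n. U (S `` {n})"])
    fix A :: "real set" assume "A \<in> null_ideal"
    from null_open_cover[OF this] obtain T :: "nat \<Rightarrow> real set" where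
      T: "\<And>n. open (T n)" "\<And>n. A \<subseteq> T n" "(\<Inter>n. T n) \<in> null_ideal" by blast
    have "\<forall>n. \<exists>S. U S = T n" using U T(1) by blast
    then obtain S where S: "\<And>n. U (S n) = T n" by metis
    have "Sigma UNIV S `` {n} = S n" for n by blast
    then have eq: "(\<Inter>n. U (Sigma UNIV S `` {n})) = (\<Inter>n. T n)" using S by simp
    have "A \<subseteq> (\<Inter>n. U (Sigma UNIV S `` {n})) \<and> (\<Inter>n. U (Sigma UNIV S `` {n})) \<in> null_ideal"
      unfolding eq using T(2,3) by blast
    then show "\<exists>S :: (nat \<times> nat) set. A \<subseteq> (\<Inter>n. U (S `` {n})) \<and> (\<Inter>n. U (S `` {n})) \<in> null_ideal"
      by (rule exI)
  qed
qed

section \<open>Upper bounds from explicit families\<close>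

lemma dominating_number_le_continuum: "dominating_number \<le>o continuum"
proof -
  have "\<exists>g\<in>UNIV. \<forall>\<^sub>F n in sequentially. f n \<le> g n" for f :: "nat \<Rightarrow> nat"
    by (rule bexI[of _ f]) simp_all
  then have "dominating_number \<le>o |UNIV :: (nat \<Rightarrow> nat) set|"
    unfolding dominating_number_def by (intro least_card(2)) blast+
  also have "inj (\<lambda>f :: nat \<Rightarrow> nat. {(n, f n) |n. True})"
    by (rule injI) (auto simp: fun_eq_iff set_eq_iff)
  then have "|UNIV :: (nat \<Rightarrow> nat) set| \<le>o |UNIV :: (nat \<times> nat) set set|"
    by (rule card_of_ordLeqI) simp
  also note card_of_nat_rel
  finally (ordLeq_transitive) show ?thesis .
qed

text \<open>No set splits itself or its complement, and one of the two is infinite. Hence the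
  reaping number is a minimum over a non-empty collection of families.\<close>

lemma unsplit_all_infinite: "\<not> (\<exists>y. \<forall>x\<in>{x. infinite x}. splits y x)"
proof
  assume "\<exists>y. \<forall>x\<in>{x. infinite x}. splits y x"
  then obtain y where y: "\<And>x. infinite x \<Longrightarrow> splits y x" by blast
  show False
  proof (cases "finite y")
    case True
    then have "infinite (- y)" by simp
    from y[OF this] show False unfolding splits_def by simp
  next
    case False
    from y[OF this] show False unfolding splits_def by simp
  qed
qed

lemma reaping_number_le_continuum: "reaping_number \<le>o continuum"
proof -
  have "(\<forall>x\<in>{x. infinite x}. infinite x) \<and> \<not> (\<exists>y. \<forall>x\<in>{x. infinite x}. splits y x)"
    using unsplit_all_infinite by simp
  then have "reaping_number \<le>o |{x :: nat set. infinite x}|"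
    unfolding reaping_number_def by (intro least_card(2))
  also have "|{x :: nat set. infinite x}| \<le>o |UNIV :: nat set set|" by (rule card_of_mono1) simp
  also have "|UNIV :: nat set set| =o continuum"
    using nat_sets_eqpoll_reals by (simp only: eqpoll_iff_card_of_ordIso)
  finally (ordLeq_ordIso_trans) show ?thesis .
qed

lemma singleton_meagre: "{x} \<in> meagre_sets"
  unfolding meagre_sets_def by (auto intro!: exI[of _ "\<lambda>_. {x}"])

lemma cov_meagre_le_continuum: "cov meagre_sets \<le>o continuum"
proof -
  have "range (\<lambda>x. {x}) \<subseteq> meagre_sets \<and> \<Union> (range (\<lambda>x. {x})) = UNIV"
    using singleton_meagre by auto
  then have "cov meagre_sets \<le>o |range (\<lambda>x :: real. {x})|"
    unfolding cov_def by (intro least_card(2))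
  also have "|range (\<lambda>x :: real. {x})| \<le>o continuum" by (rule card_of_image)
  finally (ordLeq_transitive) show ?thesis .
qed

lemma UNIV_not_null: "(UNIV :: real set) \<notin> null_ideal"
  by (simp add: null_sets_def)

lemma non_null_le_continuum: "non null_ideal \<le>o continuum"
  unfolding non_def by (rule least_card(2)) (rule UNIV_not_null)+

section \<open>Lower bounds\<close>

text \<open>The witness \<open>A0\<close> ensures that \<open>least_card\<close> is an attained
  minimum; a minimal set smaller than the continuum is then excluded.\<close>

lemma least_card_eq_continuum:
  assumes "least_card P \<le>o continuum" "P A0" and "\<And>A. |A| <o continuum \<Longrightarrow> \<not> P A"
  shows "least_card P =o continuum"
proof -
  obtain A where A: "P A" "least_card P = |A|" using least_card(1)[of P, OF assms(2)] by blast
  then have "\<not> |A| <o continuum" using assms(3) by blast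
  then have "continuum \<le>o |A|"
    using not_ordLess_iff_ordLeq[OF card_of_Well_order card_of_Well_order] by blast
  then show ?thesis using assms(1) A(2) ordIso_iff_ordLeq by metis
qed


text \<open>The inequality between \<open>non\<close> and \<open>cof\<close> in Cichon's diagram,
  carried out directly: the null set that escapes every member of \<open>F\<close> consists of the
  chosen points.\<close>

lemma local_grMA_not_cofinal_null:
  assumes MA: "local_grMA TYPE('k)" and "|F| <o continuum" and F: "F \<subseteq> null_ideal"
  shows "\<not> (\<forall>A\<in>null_ideal. \<exists>B\<in>F. A \<subseteq> B)"
proof
  assume cofinal: "\<forall>A\<in>null_ideal. \<exists>B\<in>F. A \<subseteq> B"
  have "\<forall>B\<in>F. \<exists>x. x \<notin> B" using F UNIV_not_null by (metis UNIV_eq_I subsetD)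
  then obtain x where x: "\<And>B. B \<in> F \<Longrightarrow> x B \<notin> B" by metis
  have "|x ` F| <o continuum" using card_of_image assms(2) by (rule ordLeq_ordLess_trans)
  then have "x ` F \<in> null_ideal" by (rule local_grMA_null[OF MA])
  then obtain B where "B \<in> F" "x ` F \<subseteq> B" using cofinal by blast
  then show False using x by blast
qed

theorem corollary11:
  assumes "local_grMA TYPE('k)"
  shows "cov meagre_sets =o continuum
       \<and> dominating_number =o continuum
       \<and> cof meagre_sets =o continuum
       \<and> non null_ideal =o continuum
       \<and> cof null_ideal =o continuum
       \<and> reaping_number =o continuum"
proof (intro conjI)
  have singleton: "\<exists>B\<in>meagre_sets. x \<in> B" for x
    using singleton_meagre by blast
  show "cov meagre_sets =o continuum"
    unfolding cov_def
  proof (rule least_card_eq_continuum)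
    show "meagre_sets \<subseteq> meagre_sets \<and> \<Union> meagre_sets = UNIV" using singleton by blast
    show "\<not> (F \<subseteq> meagre_sets \<and> \<Union> F = UNIV)" if "|F| <o continuum" for F
      using local_grMA_avoid_meagre[OF assms _ that] by blast
  qed (rule cov_meagre_le_continuum[unfolded cov_def])
  show "dominating_number =o continuum"
    unfolding dominating_number_def
  proof (rule least_card_eq_continuum)
    show "\<forall>f :: nat \<Rightarrow> nat. \<exists>g\<in>UNIV. \<forall>\<^sub>F n in sequentially. f n \<le> g n"
      by (rule allI, rule_tac x = f in bexI) simp_all
    show "\<not> (\<forall>f. \<exists>g\<in>F. \<forall>\<^sub>F n in sequentially. f n \<le> g n)"
      if "|F| <o continuum" for F :: "(nat \<Rightarrow> nat) set"
      using local_grMA_undominated[OF assms that] by blast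
  qed (rule dominating_number_le_continuum[unfolded dominating_number_def])
  show "cof meagre_sets =o continuum"
    unfolding cof_def
  proof (rule least_card_eq_continuum)
    show "meagre_sets \<subseteq> meagre_sets \<and> (\<forall>A\<in>meagre_sets. \<exists>B\<in>meagre_sets. A \<subseteq> B)" by blast
    show "\<not> (F \<subseteq> meagre_sets \<and> (\<forall>A\<in>meagre_sets. \<exists>B\<in>F. A \<subseteq> B))" if "|F| <o continuum" for F
    proof
      assume F: "F \<subseteq> meagre_sets \<and> (\<forall>A\<in>meagre_sets. \<exists>B\<in>F. A \<subseteq> B)"
      \<comment> \<open>Singletons are meagre, so a cofinal family covers the line:
        \<open>cov\<close> is at most \<open>cof\<close>.\<close>
      then have "\<Union> F = UNIV" using singleton by blast
      then show False using local_grMA_avoid_meagre[OF assms _ that] F by blast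
    qed
  qed (rule cof_meagre_le_continuum[unfolded cof_def])
  show "non null_ideal =o continuum"
    unfolding non_def
  proof (rule least_card_eq_continuum)
    show "\<not> A \<notin> null_ideal" if "|A| <o continuum" for A
      using local_grMA_null[OF assms that] by simp
  qed (rule non_null_le_continuum[unfolded non_def], rule UNIV_not_null)
  show "cof null_ideal =o continuum"
    unfolding cof_def
  proof (rule least_card_eq_continuum)
    show "null_ideal \<subseteq> null_ideal \<and> (\<forall>A\<in>null_ideal. \<exists>B\<in>null_ideal. A \<subseteq> B)" by blast
    show "\<not> (F \<subseteq> null_ideal \<and> (\<forall>A\<in>null_ideal. \<exists>B\<in>F. A \<subseteq> B))" if "|F| <o continuum" for F
      using local_grMA_not_cofinal_null[OF assms that] by blast
  qed (rule cof_null_le_continuum[unfolded cof_def])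
  show "reaping_number =o continuum"
    unfolding reaping_number_def
  proof (rule least_card_eq_continuum)
    show "(\<forall>x\<in>{x. infinite x}. infinite x) \<and> \<not> (\<exists>y. \<forall>x\<in>{x. infinite x}. splits y x)"
      using unsplit_all_infinite by simp
    show "\<not> ((\<forall>x\<in>R. infinite x) \<and> \<not> (\<exists>y. \<forall>x\<in>R. splits y x))" if "|R| <o continuum" for R
      using local_grMA_split[OF assms that] by blast
  qed (rule reaping_number_le_continuum[unfolded reaping_number_def])
qed

end
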